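(* Let $d\ge 2$, let $\Gamma=F_d$ be the non-abelian free group of rank $d$, and let $\mu$ be the uniform probability measure on a symmetric free generating set $\{a_1^{\pm1},\dots,a_d^{\pm1}\}$ of $F_d$ (where $a_1,\dots,a_d$ freely generate $F_d$). Then there is a family of $(\Gamma,\mu)$-boundaries $(B_n,\nu_n)$, $n\in\mathbf{N}$, such that for every $\epsilon>0$ there is an $n$ with $$h_{RW}(\mu) > h_\mu(B_n,\nu_n) > \frac{d-2}{2d-2}\,h_{RW}(\mu)-\epsilon .$$
   Context: Let $\Gamma$ be a countable discrete group and $\mu$ a probability measure on $\Gamma$. A standard (Lebesgue) probability space $(X,\lambda)$ with a measurable $\Gamma$-action is $(\Gamma,\mu)$-stationary if $\mu*\lambda=\lambda$, where $\mu*\lambda=\sum_{g\in\Gamma}\mu(g)\,g\lambda$ and $g\lambda$ is the push-forward of $\lambda$ by $g$. Up to measurable isomorphism one may assume $X$ is compact metrizable and the action is continuous. A $(\Gamma,\mu)$-boundary is a $(\Gamma,\mu)$-stationary space $(B,\nu)$ that is $\mu$-proximal: for $\mu^{\mathbf{N}}$-almost every sequence $(g_i)\in\Gamma^{\mathbf{N}}$, the weak* limit $\lim_n g_1\cdots g_n\nu$ is a Dirac mass. The Furstenberg entropy of a $(\Gamma,\mu)$-stationary space $(X,\lambda)$ is $$h_\mu(X,\lambda)=\int_\Gamma\int_X -\log\left(\frac{d g^{-1}\lambda}{d\lambda}(x)\right)d\lambda(x)\,d\mu(g).$$ The random walk (Avez) entropy is $h_{RW}(\mu)=\lim_{n\to\infty}\frac{H(\mu^n)}{n}$,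 where $\mu^n$ is the $n$-fold convolution power and $H(\mu^n)=\sum_{g}-\log(\mu^n(g))\,\mu^n(g)$ is Shannon entropy. *)

theory Defs
  imports "HOL-Probability.Probability" "HOL-Algebra.Group_Action" "HOL-Algebra.Generated_Groups"
begin

text \<open>
  A word in the letters \<open>a i\<close> and their inverses is a list of pairs \<open>(i, b)\<close>, where
  \<open>(i, True)\<close> stands for \<open>a i\<close> and \<open>(i, False)\<close> for its inverse.
\<close>

definition reduced_word :: "('i \<times> bool) list \<Rightarrow> bool" where
  "reduced_word w \<longleftrightarrow> successively (\<lambda>x y. \<not> (fst x = fst y \<and> snd x \<noteq> snd y)) w"

definition eval_word :: "('g, 'm) monoid_scheme \<Rightarrow> ('i \<Rightarrow> 'g) \<Rightarrow> ('i \<times> bool) list \<Rightarrow> 'g" where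
  "eval_word G a w =
     foldr (\<lambda>(i, b) x. (if b then a i else inv\<^bsub>G\<^esub> (a i)) \<otimes>\<^bsub>G\<^esub> x) w \<one>\<^bsub>G\<^esub>"

text \<open>
  No non-empty reduced word is trivial in \<open>G\<close>. This entails that \<open>a\<close> is injective on \<open>I\<close>,
  so \<open>G\<close> is free of rank \<open>card I\<close>.
\<close>

definition freely_generates :: "('g, 'm) monoid_scheme \<Rightarrow> 'i set \<Rightarrow> ('i \<Rightarrow> 'g) \<Rightarrow> bool" where
  "freely_generates G I a \<longleftrightarrow>
     a ` I \<subseteq> carrier G \<and> generate G (a ` I) = carrier G \<and>
     (\<forall>w. w \<noteq> [] \<and> fst ` set w \<subseteq> I \<and> reduced_word w \<longrightarrow> eval_word G a w \<noteq> \<one>\<^bsub>G\<^esub>)"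

definition symmetric_set :: "('g, 'm) monoid_scheme \<Rightarrow> 'i set \<Rightarrow> ('i \<Rightarrow> 'g) \<Rightarrow> 'g set" where
  "symmetric_set G I a = a ` I \<union> (\<lambda>i. inv\<^bsub>G\<^esub> (a i)) ` I"


primrec conv_power :: "('g, 'm) monoid_scheme \<Rightarrow> 'g pmf \<Rightarrow> nat \<Rightarrow> 'g pmf" where
  "conv_power G \<mu> 0 = return_pmf \<one>\<^bsub>G\<^esub>"
| "conv_power G \<mu> (Suc n) = bind_pmf (conv_power G \<mu> n) (\<lambda>g. map_pmf (\<lambda>h. g \<otimes>\<^bsub>G\<^esub> h) \<mu>)"

text \<open>
  The sums and integrals defining the entropies below are real-valued, hence \<open>0\<close> by convention if
  they diverge; they converge whenever \<open>\<mu>\<close> has finite symmetric support (and, for the Furstenberg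
  entropy, the measure is stationary, as then the Radon-Nikodym derivatives are bounded away from
  \<open>0\<close> and infinity).
\<close>

definition shannon_entropy :: "'g pmf \<Rightarrow> real" where
  "shannon_entropy p = (\<Sum>\<^sub>\<infinity>g. - ln (pmf p g) * pmf p g)"

definition rw_entropy :: "('g, 'm) monoid_scheme \<Rightarrow> 'g pmf \<Rightarrow> real" where
  "rw_entropy G \<mu> = lim (\<lambda>n. shannon_entropy (conv_power G \<mu> n) / real n)"


definition borel_of :: "'x topology \<Rightarrow> 'x measure" where
  "borel_of X = sigma (topspace X) {U. openin X U}"

definition weak_star_limit :: "'x topology \<Rightarrow> (nat \<Rightarrow> 'x measure) \<Rightarrow> 'x measure \<Rightarrow> bool" where
  "weak_star_limit X M N \<longleftrightarrow>
     (\<forall>f. continuous_map X euclideanreal f \<longrightarrow>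
        (\<lambda>n. \<integral>x. f x \<partial>M n) \<longlonglongrightarrow> (\<integral>x. f x \<partial>N))"

definition continuous_action ::
    "('g, 'm) monoid_scheme \<Rightarrow> 'x topology \<Rightarrow> ('g \<Rightarrow> 'x \<Rightarrow> 'x) \<Rightarrow> bool" where
  "continuous_action G X act \<longleftrightarrow>
     group_action G (topspace X) act \<and> (\<forall>g\<in>carrier G. continuous_map X X (act g))"

text \<open>
  Stationary spaces are taken in a compact metrizable model with a continuous action. The last
  clause is \<open>\<mu> * \<nu> = \<nu>\<close>; the integral over \<open>\<mu>\<close> is the sum of \<open>\<mu>(g) (g \<nu>)(A)\<close> over \<open>g\<close>.
\<close>

definition stationary_space ::
    "('g, 'm) monoid_scheme \<Rightarrow> 'g pmf \<Rightarrow> 'x topology \<Rightarrow> ('g \<Rightarrow> 'x \<Rightarrow> 'x) \<Rightarrow> 'x measure \<Rightarrow> bool" where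
  "stationary_space G \<mu> X act \<nu> \<longleftrightarrow>
     set_pmf \<mu> \<subseteq> carrier G \<and>
     compact_space X \<and> metrizable_space X \<and> continuous_action G X act \<and>
     prob_space \<nu> \<and> sets \<nu> = sets (borel_of X) \<and>
     (\<forall>A\<in>sets \<nu>. (\<integral>\<^sup>+g. emeasure (distr \<nu> \<nu> (act g)) A \<partial>measure_pmf \<mu>) = emeasure \<nu> A)"

primrec walk :: "('g, 'm) monoid_scheme \<Rightarrow> (nat \<Rightarrow> 'g) \<Rightarrow> nat \<Rightarrow> 'g" where
  "walk G \<omega> 0 = \<one>\<^bsub>G\<^esub>"
| "walk G \<omega> (Suc n) = walk G \<omega> n \<otimes>\<^bsub>G\<^esub> \<omega> n"

definition proximal ::
    "('g, 'm) monoid_scheme \<Rightarrow> 'g pmf \<Rightarrow> 'x topology \<Rightarrow> ('g \<Rightarrow> 'x \<Rightarrow> 'x) \<Rightarrow> 'x measure \<Rightarrow> bool" where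
  "proximal G \<mu> X act \<nu> \<longleftrightarrow>
     (AE \<omega> in (\<Pi>\<^sub>M i\<in>(UNIV :: nat set). measure_pmf \<mu>).
        \<exists>x\<in>topspace X.
          weak_star_limit X (\<lambda>n. distr \<nu> \<nu> (act (walk G \<omega> n))) (return (borel_of X) x))"

definition boundary ::
    "('g, 'm) monoid_scheme \<Rightarrow> 'g pmf \<Rightarrow> 'x topology \<Rightarrow> ('g \<Rightarrow> 'x \<Rightarrow> 'x) \<Rightarrow> 'x measure \<Rightarrow> bool" where
  "boundary G \<mu> X act \<nu> \<longleftrightarrow> stationary_space G \<mu> X act \<nu> \<and> proximal G \<mu> X act \<nu>"

text \<open>Note that \<open>RN_deriv M N\<close> is the density of \<open>N\<close> with respect to \<open>M\<close>.\<close>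

definition furstenberg_entropy ::
    "('g, 'm) monoid_scheme \<Rightarrow> 'g pmf \<Rightarrow> ('g \<Rightarrow> 'x \<Rightarrow> 'x) \<Rightarrow> 'x measure \<Rightarrow> real" where
  "furstenberg_entropy G \<mu> act \<nu> =
     (\<integral>g. (\<integral>x. - ln (enn2real (RN_deriv \<nu> (distr \<nu> \<nu> (act (inv\<^bsub>G\<^esub> g))) x)) \<partial>\<nu>)
        \<partial>measure_pmf \<mu>)"

text \<open>
  The points of a compact metrizable space can be taken in the type \<open>nat \<Rightarrow> real\<close> (every such space
  embeds in the Hilbert cube), so families of boundaries may be sought as topologies on subsets
  of that type.
\<close>

type_synonym point = "nat \<Rightarrow> real"

end

theory Submission
  imports Defs "HOL-Real_Asymp.Real_Asymp"
begin

text \<open>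
  A single boundary serves all \<open>\<epsilon>\<close>. Killing the generator \<open>a d\<close> maps the walk to a lazy simple random
  walk on the free group of rank \<open>d - 1\<close>. For \<open>d \<ge> 3\<close> this walk is transient, and the space of
  infinite reduced words in \<open>d - 1\<close> letters with the uniform measure is a boundary of entropy
  \<open>(d - 2) / d * ln (2 * d - 3)\<close>. On the other hand \<open>h\<^sub>R\<^sub>W = (d - 1) / d * ln (2 * d - 1)\<close>: the walk has
  speed \<open>(d - 1) / d\<close>, and the logarithm of its law at \<open>g\<close> is \<open>- \<bar>g\<bar> * ln (2 * d - 1)\<close> up to
  a sublinear error on average. The required inequalities follow from \<open>2 * d - 1 \<le> (2 * d - 3)\<^sup>2\<close>. For
  \<open>d = 2\<close> the lower bound is negative and a one-point space suffices.
\<close>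

section \<open>Reduced words and rays\<close>

text \<open>Everything is done for the quotient free group on the first n generators, n \<le> d: n =
  d yields the word length that governs h_RW, n = d - 1 the boundary. The boundary for n has entropy
  (n - 1) / d * ln (2n - 1). Two functions of the reduced length |w| drive the estimates. Averaging
  (2n - 1)^(-|w|/2) over one step contracts it by a factor below 1 if n \<ge> 2, so short words have
  exponentially small probability; this controls both the returns that disturb the speed and the
  convergence to the boundary. The function (2d - 1)^(-|w|) dominates the law of the walk and has
  linear total mass on balls, which bounds the Shannon entropy from both sides. \<Gamma> is an
  abstract group with a free basis, so actions are built from words: one map per letter, inverse
  letters acting inversely, is replayed along any word for the element, and freeness makes the
  choice of word irrelevant. The factor (d - 2) / (2d - 2) turns h_RW into (d - 2) / (2d) * ln (2d -
  1); the 2 in this denominator is what the square in the final inequality pays for.\<close>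

text \<open>
  The letter \<open>a i\<close> is encoded by the real number \<open>i\<close> and its inverse by \<open>-i\<close>. This makes rays
  (infinite reduced words) elements of the type \<open>point\<close>.
\<close>

definition letters :: "nat \<Rightarrow> real set" where
  "letters n = real ` {1..n} \<union> (\<lambda>i. - real i) ` {1..n}"

lemma finite_letters [simp]: "finite (letters n)"
  by (simp add: letters_def)

lemma card_letters: "card (letters n) = 2 * n"
proof -
  have "card (letters n) = card (real ` {1..n}) + card ((\<lambda>i. - real i) ` {1..n})"
    unfolding letters_def by (rule card_Un_disjoint) auto
  also have "\<dots> = n + n"
    by (subst (1 2) card_image) (auto simp: inj_on_def)
  finally show ?thesis by simp
qed

lemma uminus_letters [simp]: "- x \<in> letters n \<longleftrightarrow> x \<in> letters n"
  by (force simp: letters_def)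

lemma letters_neq_uminus: "x \<in> letters n \<Longrightarrow> x \<noteq> - x"
  by (auto simp: letters_def)

lemma letters_restrict: "n \<le> m \<Longrightarrow> letters n = {x \<in> letters m. \<bar>x\<bar> \<le> real n}"
  by (auto simp: letters_def)

section \<open>Free groups as reduced words: left multiplication by a letter on normal forms\<close>

definition push :: "real \<Rightarrow> real list \<Rightarrow> real list" where
  "push x w = (if w \<noteq> [] \<and> hd w = - x then tl w else x # w)"

definition words :: "nat \<Rightarrow> real list set" where
  "words n = {w. set w \<subseteq> letters n \<and> successively (\<lambda>x y. y \<noteq> - x) w}"

lemma Nil_words [simp]: "[] \<in> words n"
  by (simp add: words_def)

lemma Cons_words: "x # w \<in> words n \<longleftrightarrow> x \<in> letters n \<and> w \<in> words n \<and> (w \<noteq> [] \<longrightarrow> hd w \<noteq> - x)"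
  by (cases w) (auto simp: words_def)

lemma append_words: "u @ v \<in> words n \<longleftrightarrow>
    u \<in> words n \<and> v \<in> words n \<and> (u \<noteq> [] \<and> v \<noteq> [] \<longrightarrow> hd v \<noteq> - last u)"
  by (auto simp: words_def successively_append_iff)

lemma push_words: "x \<in> letters n \<Longrightarrow> w \<in> words n \<Longrightarrow> push x w \<in> words n"
  by (cases w) (auto simp: push_def Cons_words)

lemma push_uminus_push: "w \<in> words n \<Longrightarrow> push (- x) (push x w) = w"
  by (cases w; cases "tl w") (auto simp: push_def Cons_words)

lemma push_uminus_words: "w \<in> words n \<Longrightarrow> map uminus (rev w) \<in> words n"
proof (induction w)
  case (Cons x w)
  then show ?case
    by (auto simp: append_words Cons_words last_map last_rev)
qed auto

text \<open>Acting on \<open>[x]\<close> instead of \<open>[]\<close> amounts to multiplying by x on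
  the right; this turns the left action into information about the end of a word.\<close>

lemma foldr_push_singleton:
  assumes "w \<in> words n"
  shows "foldr push w [x] = (if w \<noteq> [] \<and> last w = - x then butlast w else w @ [x])"
  using assms
proof (induction w)
  case (Cons y v)
  then show ?case
    by (cases v) (auto simp: Cons_words push_def)
qed auto

text \<open>In the cancelling case \<open>T x\<close> undoes the \<open>T (- x)\<close> contributed
  by the head of \<open>w\<close>. Hence free reduction does not change what a word does.\<close>

lemma foldr_push:
  assumes T: "\<And>x s. x \<in> letters n \<Longrightarrow> s \<in> S \<Longrightarrow> T x s \<in> S"
      "\<And>x s. x \<in> letters n \<Longrightarrow> s \<in> S \<Longrightarrow> T (- x) (T x s) = s"
    and "x \<in> letters n" "set w \<subseteq> letters n" "s \<in> S"
  shows "foldr T (push x w) s = T x (foldr T w s)"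
proof -
  have "foldr T u s \<in> S" if "set u \<subseteq> letters n" for u
    using that by (induction u) (auto simp: T assms(5))
  then show ?thesis
    using T(2)[of "- x" "foldr T (tl w) s"] assms(3,4) by (cases w) (auto simp: push_def)
qed

text \<open>For \<open>T = push\<close> this is the homomorphism that sends every generator of index
  above n to the identity and keeps the others.\<close>

definition kill :: "nat \<Rightarrow> (real \<Rightarrow> 's \<Rightarrow> 's) \<Rightarrow> real \<Rightarrow> 's \<Rightarrow> 's" where
  "kill n T x s = (if \<bar>x\<bar> \<le> real n then T x s else s)"

lemma kill_push_words:
  "n \<le> d \<Longrightarrow> x \<in> letters d \<Longrightarrow> w \<in> words n \<Longrightarrow> kill n push x w \<in> words n"
  using push_words[of x n w] letters_restrict[of n d] by (auto simp: kill_def)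

lemma kill_push_uminus: "w \<in> words n \<Longrightarrow> kill n push (- x) (kill n push x w) = w"
  by (simp add: kill_def push_uminus_push)

text \<open>The killed action factors through the reduced image of w in the free group on n letters,
  so orbits can be studied through that reduced word alone.\<close>

lemma foldr_kill:
  assumes T: "\<And>x s. x \<in> letters n \<Longrightarrow> s \<in> S \<Longrightarrow> T x s \<in> S"
      "\<And>x s. x \<in> letters n \<Longrightarrow> s \<in> S \<Longrightarrow> T (- x) (T x s) = s"
    and "n \<le> d" "set w \<subseteq> letters d" "s \<in> S"
  shows "foldr (kill n T) w s = foldr T (foldr (kill n push) w []) s"
  using assms(4)
proof (induction w)
  case (Cons x w)
  have "foldr (kill n push) w [] \<in> words n"
    using Cons.prems by (induction w) (auto intro!: kill_push_words[OF assms(3)])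
  then have "set (foldr (kill n push) w []) \<subseteq> letters n"
    by (simp add: words_def)
  then have "foldr T (push x (foldr (kill n push) w [])) s =
      T x (foldr T (foldr (kill n push) w []) s)" if "x \<in> letters n"
    using that by (intro foldr_push[where n = n and S = S]) (auto simp: T assms(5))
  with Cons letters_restrict[OF assms(3)] show ?case
    by (auto simp: kill_def[of _ _ x])
qed simp

section \<open>Letters acting on infinite reduced words\<close>

definition rays :: "nat \<Rightarrow> point set" where
  "rays n = {\<xi>. \<forall>i. \<xi> i \<in> letters n \<and> \<xi> (Suc i) \<noteq> - \<xi> i}"

definition ray_push :: "real \<Rightarrow> point \<Rightarrow> point" where
  "ray_push x \<xi> = (if \<xi> 0 = - x then (\<lambda>i. \<xi> (Suc i)) else case_nat x \<xi>)"

lemma ray_push_rays: "x \<in> letters n \<Longrightarrow> \<xi> \<in> rays n \<Longrightarrow> ray_push x \<xi> \<in> rays n"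
  by (auto simp: rays_def ray_push_def split: nat.splits)

lemma ray_push_uminus_push: "\<xi> \<in> rays n \<Longrightarrow> ray_push (- x) (ray_push x \<xi>) = \<xi>"
  by (auto simp: rays_def ray_push_def fun_eq_iff dest: spec[of _ 0] split: nat.splits)

lemma kill_ray_push_rays:
  "n \<le> d \<Longrightarrow> x \<in> letters d \<Longrightarrow> \<xi> \<in> rays n \<Longrightarrow> kill n ray_push x \<xi> \<in> rays n"
  using ray_push_rays[of x n \<xi>] letters_restrict[of n d] by (auto simp: kill_def)

lemma kill_ray_push_uminus: "\<xi> \<in> rays n \<Longrightarrow> kill n ray_push (- x) (kill n ray_push x \<xi>) = \<xi>"
  by (simp add: kill_def ray_push_uminus_push)


section \<open>Actions of free groups\<close>

locale free_basis = group \<Gamma> for \<Gamma> :: "('g, 'm) monoid_scheme" (structure) +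
  fixes a :: "nat \<Rightarrow> 'g" and d :: nat
  assumes free: "freely_generates \<Gamma> {1..d} a"
begin

definition gen :: "real \<Rightarrow> 'g" where
  "gen x = (if x > 0 then a (nat \<lfloor>x\<rfloor>) else inv (a (nat \<lfloor>- x\<rfloor>)))"

definition ev :: "real list \<Rightarrow> 'g" where
  "ev w = foldr (\<lambda>x g. gen x \<otimes> g) w \<one>"

lemma a_closed: "i \<in> {1..d} \<Longrightarrow> a i \<in> carrier \<Gamma>"
  using free by (auto simp: freely_generates_def)

lemma gen_closed [simp]: "x \<in> letters d \<Longrightarrow> gen x \<in> carrier \<Gamma>"
  using a_closed by (auto simp: letters_def gen_def)

lemma gen_uminus: "x \<in> letters d \<Longrightarrow> gen (- x) = inv (gen x)"
  using a_closed by (auto simp: letters_def gen_def)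

lemma gen_cancel: "x \<in> letters d \<Longrightarrow> g \<in> carrier \<Gamma> \<Longrightarrow> gen (- x) \<otimes> (gen x \<otimes> g) = g"
  by (simp add: gen_uminus flip: m_assoc)

lemma ev_Nil [simp]: "ev [] = \<one>" and ev_Cons [simp]: "ev (x # w) = gen x \<otimes> ev w"
  by (simp_all add: ev_def)

lemma ev_closed [simp]: "set w \<subseteq> letters d \<Longrightarrow> ev w \<in> carrier \<Gamma>"
  by (induction w) auto

lemma ev_append: "set u \<subseteq> letters d \<Longrightarrow> set v \<subseteq> letters d \<Longrightarrow> ev (u @ v) = ev u \<otimes> ev v"
  by (induction u) (auto simp: m_assoc)

lemma ev_uminus: "set w \<subseteq> letters d \<Longrightarrow> ev (map uminus (rev w)) = inv (ev w)"
proof (induction w)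
  case (Cons x w)
  then have "ev (map uminus (rev w) @ [- x]) = inv (ev w) \<otimes> inv (gen x)"
    by (subst ev_append) (auto simp: gen_uminus)
  then show ?case using Cons.prems by (simp add: inv_mult_group)
qed auto

lemma ev_push: "x \<in> letters d \<Longrightarrow> set w \<subseteq> letters d \<Longrightarrow> ev (push x w) = gen x \<otimes> ev w"
  by (cases w) (auto simp: push_def gen_uminus simp flip: m_assoc)

lemma ev_neq_one:
  assumes "w \<in> words d" "w \<noteq> []"
  shows "ev w \<noteq> \<one>"
proof -
  \<comment> \<open>Translation of a real letter into the pair of index and sign that
    \<open>freely_generates\<close> speaks about.\<close>
  define dec where "dec x = (nat \<lfloor>\<bar>x\<bar>\<rfloor>, x > 0)" for x :: real
  have gen_dec: "gen x = (case dec x of (i, b) \<Rightarrow> if b then a i else inv (a i))" for x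
    by (simp add: gen_def dec_def)
  have 1: "ev w = eval_word \<Gamma> a (map dec w)" for w
    by (induction w) (auto simp: eval_word_def gen_dec split: prod.splits)
  have 2: "y = - x" if "x \<in> letters d" "y \<in> letters d" "fst (dec x) = fst (dec y)"
      "snd (dec x) \<noteq> snd (dec y)" for x y
    using that by (auto simp: dec_def letters_def)
  have "set w \<subseteq> letters d"
    using assms by (simp add: words_def)
  moreover have "successively (\<lambda>x y. y \<noteq> - x) w"
    using assms by (simp add: words_def)
  ultimately have "reduced_word (map dec w)"
    unfolding reduced_word_def successively_map
    by (elim successively_mono) (use 2 in blast)
  moreover have "fst ` set (map dec w) \<subseteq> {1..d}"
    using \<open>set w \<subseteq> letters d\<close> by (force simp: dec_def letters_def)
  ultimately show ?thesis
    using free assms(2) unfolding 1 freely_generates_def by blast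
qed

lemma ev_surj:
  assumes "g \<in> carrier \<Gamma>"
  shows "\<exists>w. set w \<subseteq> letters d \<and> ev w = g"
proof -
  have "g \<in> generate \<Gamma> (a ` {1..d})"
    using assms free by (simp add: freely_generates_def)
  then show ?thesis
  proof (induction rule: generate.induct)
    case one
    show ?case by (rule exI[of _ "[]"]) simp
  next
    case (incl h)
    then obtain i where i: "i \<in> {1..d}" "h = a i" by blast
    then have "h = gen (real i)" by (simp add: gen_def)
    with i show ?case
      by (intro exI[of _ "[real i]"]) (auto simp: letters_def a_closed)
  next
    case (inv h)
    then obtain i where i: "i \<in> {1..d}" "h = a i" by blast
    then have "inv h = gen (- real i)" by (simp add: gen_def)
    with i show ?case
      by (intro exI[of _ "[- real i]"]) (auto simp: letters_def a_closed)
  next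
    case (eng g h)
    then obtain u v where "set u \<subseteq> letters d" "ev u = g" "set v \<subseteq> letters d" "ev v = h"
      by blast
    then show ?case by (intro exI[of _ "u @ v"]) (auto simp: ev_append)
  qed
qed

lemma inj_on_gen: "inj_on gen (letters d)"
proof (rule inj_onI, rule ccontr)
  fix x y assume xy: "x \<in> letters d" "y \<in> letters d" "gen x = gen y" "x \<noteq> y"
  then have "ev [x, - y] \<noteq> \<one>"
    by (intro ev_neq_one) (auto simp: Cons_words)
  with xy show False by (simp add: gen_uminus)
qed

lemma gen_image_letters: "gen ` letters d = symmetric_set \<Gamma> {1..d} a"
  unfolding letters_def symmetric_set_def image_Un image_image by (simp add: gen_def)

text \<open>An arbitrary word for g, reduced or not; \<open>foldr_cong_ev\<close> shows that the
  action does not depend on the choice.\<close>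

definition rep :: "'g \<Rightarrow> real list" where
  "rep g = (SOME w. set w \<subseteq> letters d \<and> ev w = g)"

lemma rep: "g \<in> carrier \<Gamma> \<Longrightarrow> set (rep g) \<subseteq> letters d" "g \<in> carrier \<Gamma> \<Longrightarrow> ev (rep g) = g"
  using someI_ex[OF ev_surj, of g] by (auto simp: rep_def)

text \<open>The restriction is forced by \<open>Bij\<close>, whose members are extensional on
  \<open>S\<close>.\<close>

definition letter_action :: "(real \<Rightarrow> 's \<Rightarrow> 's) \<Rightarrow> 's set \<Rightarrow> 'g \<Rightarrow> 's \<Rightarrow> 's" where
  "letter_action T S g = restrict (foldr T (rep g)) S"

end

section \<open>From letter maps to a group action\<close>

locale free_basis_action = free_basis \<Gamma> a d
  for \<Gamma> :: "('g, 'm) monoid_scheme" (structure) and a d +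
  fixes T :: "real \<Rightarrow> 's \<Rightarrow> 's" and S :: "'s set"
  assumes T_closed: "x \<in> letters d \<Longrightarrow> s \<in> S \<Longrightarrow> T x s \<in> S"
    and T_uminus: "x \<in> letters d \<Longrightarrow> s \<in> S \<Longrightarrow> T (- x) (T x s) = s"
begin

lemma foldr_closed: "set w \<subseteq> letters d \<Longrightarrow> s \<in> S \<Longrightarrow> foldr T w s \<in> S"
  by (induction w) (auto simp: T_closed)

lemma foldr_uminus:
  "set w \<subseteq> letters d \<Longrightarrow> s \<in> S \<Longrightarrow> foldr T (map uminus (rev w)) (foldr T w s) = s"
  by (induction w) (auto simp: T_uminus foldr_closed)

lemma T_push:
  "x \<in> letters d \<Longrightarrow> set w \<subseteq> letters d \<Longrightarrow> s \<in> S \<Longrightarrow>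
    foldr T (push x w) s = T x (foldr T w s)"
  by (rule foldr_push[where n = d and S = S]) (auto simp: T_closed T_uminus)

text \<open>Freeness enters here. Reducing w by \<open>push\<close> preserves both its value and its
  action, and a reduced word of value \<one> is empty.\<close>

lemma foldr_eq_if_ev_one:
  assumes "set w \<subseteq> letters d" "ev w = \<one>" "s \<in> S"
  shows "foldr T w s = s"
proof -
  have *: "foldr push w [] \<in> words d \<and> ev (foldr push w []) = ev w \<and>
      foldr T (foldr push w []) s = foldr T w s" if "set w \<subseteq> letters d" for w
    using that
  proof (induction w)
    case (Cons x w)
    then have "foldr push w [] \<in> words d" by simp
    then have "set (foldr push w []) \<subseteq> letters d" by (simp add: words_def)
    with Cons assms(3) show ?case by (simp add: push_words ev_push T_push)
  qed auto
  with assms ev_neq_one have "foldr push w [] = []" by metis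
  with *[OF assms(1)] show ?thesis by simp
qed

text \<open>The formal inverse of u followed by v has value \<one>, hence acts trivially; applying u
  to both sides gives the claim.\<close>

lemma foldr_cong_ev:
  assumes "set u \<subseteq> letters d" "set v \<subseteq> letters d" "ev u = ev v" "s \<in> S"
  shows "foldr T u s = foldr T v s"
proof -
  have "set (map uminus (rev u)) \<subseteq> letters d"
    using assms(1) by auto
  then have "foldr T (map uminus (rev u) @ v) s = s"
    using assms by (intro foldr_eq_if_ev_one) (auto simp: ev_append ev_uminus)
  then have "foldr T (map uminus (rev (map uminus (rev u))))
      (foldr T (map uminus (rev u)) (foldr T v s)) = foldr T u s"
    by (simp add: rev_map comp_def)
  moreover have "foldr T v s \<in> S" using assms by (simp add: foldr_closed)
  ultimately show ?thesis
    using foldr_uminus[OF \<open>set (map uminus (rev u)) \<subseteq> letters d\<close>] by simp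
qed

lemma letter_action_ev:
  "set w \<subseteq> letters d \<Longrightarrow> s \<in> S \<Longrightarrow> letter_action T S (ev w) s = foldr T w s"
  using foldr_cong_ev[of "rep (ev w)" w s] rep[of "ev w"] by (simp add: letter_action_def)

lemma letter_action_closed: "g \<in> carrier \<Gamma> \<Longrightarrow> s \<in> S \<Longrightarrow> letter_action T S g s \<in> S"
  by (simp add: letter_action_def foldr_closed rep)

lemma letter_action_one: "s \<in> S \<Longrightarrow> letter_action T S \<one> s = s"
  using letter_action_ev[of "[]"] by simp

lemma letter_action_mult:
  assumes "g \<in> carrier \<Gamma>" "h \<in> carrier \<Gamma>" "s \<in> S"
  shows "letter_action T S (g \<otimes> h) s = letter_action T S g (letter_action T S h s)"
proof -
  have "g \<otimes> h = ev (rep g @ rep h)"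
    using assms by (simp add: ev_append rep)
  then have "letter_action T S (g \<otimes> h) s = foldr T (rep g @ rep h) s"
    using assms by (simp add: letter_action_ev rep)
  then show ?thesis
    using assms by (simp add: letter_action_def foldr_closed rep)
qed

lemma letter_action_gen:
  assumes "x \<in> letters d" "s \<in> S"
  shows "letter_action T S (gen x) s = T x s"
  using letter_action_ev[of "[x]" s] assms by simp

lemma letter_action_bij:
  assumes "g \<in> carrier \<Gamma>"
  shows "bij_betw (letter_action T S g) S S"
proof (rule bij_betw_byWitness[where f' = "letter_action T S (inv g)"])
  show "\<forall>s\<in>S. letter_action T S (inv g) (letter_action T S g s) = s"
    using assms letter_action_mult[of "inv g" g] by (simp add: letter_action_one)
  show "\<forall>s\<in>S. letter_action T S g (letter_action T S (inv g) s) = s"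
    using assms letter_action_mult[of g "inv g"] by (simp add: letter_action_one)
qed (use assms in \<open>auto simp: letter_action_closed\<close>)

lemma group_action_letter_action: "group_action \<Gamma> S (letter_action T S)"
proof -
  have Bij: "letter_action T S g \<in> Bij S" if "g \<in> carrier \<Gamma>" for g
    using that letter_action_bij by (simp add: Bij_def letter_action_def)
  have "letter_action T S \<in> hom \<Gamma> (BijGroup S)"
  proof (rule homI)
    fix g h assume gh: "g \<in> carrier \<Gamma>" "h \<in> carrier \<Gamma>"
    have "letter_action T S (g \<otimes> h) = compose S (letter_action T S g) (letter_action T S h)"
    proof (rule extensionalityI[of _ S])
      show "letter_action T S (g \<otimes> h) \<in> extensional S"
        by (simp add: letter_action_def)
    qed (simp_all add: compose_def letter_action_mult gh)
    then show "letter_action T S (g \<otimes> h) = letter_action T S g \<otimes>\<^bsub>BijGroup S\<^esub> letter_action T S h"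
      using gh by (simp add: BijGroup_def Bij)
  qed (simp add: BijGroup_def Bij)
  then show ?thesis
    unfolding group_action_def
    by (intro group_hom.intro group_hom_axioms.intro is_group group_BijGroup)
qed

end

section \<open>The simple random walk\<close>

lemma (in monoid) set_pmf_conv_power:
  "set_pmf \<mu> \<subseteq> carrier G \<Longrightarrow> set_pmf (conv_power G \<mu> n) \<subseteq> carrier G"
  by (induction n) auto

text \<open>\<open>conv_power\<close> appends the newest step on the right, while letters act on
  reduced words from the left. Peeling off the first step instead lets one-step recursions run
  through \<open>push\<close>.\<close>

lemma (in monoid) conv_power_Suc_left:
  assumes "set_pmf \<mu> \<subseteq> carrier G"
  shows "conv_power G \<mu> (Suc n) = bind_pmf \<mu> (\<lambda>x. map_pmf (\<lambda>g. x \<otimes> g) (conv_power G \<mu> n))"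
proof (induction n)
  case 0
  have "map_pmf (\<lambda>h. \<one> \<otimes> h) \<mu> = map_pmf (\<lambda>h. h \<otimes> \<one>) \<mu>"
    using assms by (intro map_pmf_cong) auto
  then show ?case
    by (simp add: bind_return_pmf map_pmf_def)
next
  case (Suc n)
  have "conv_power G \<mu> (Suc (Suc n)) =
      bind_pmf \<mu> (\<lambda>x. bind_pmf (conv_power G \<mu> n) (\<lambda>g. map_pmf (\<lambda>h. (x \<otimes> g) \<otimes> h) \<mu>))"
    by (subst conv_power.simps, subst Suc)
      (simp add: bind_assoc_pmf bind_map_pmf)
  also have "\<dots> = bind_pmf \<mu> (\<lambda>x. bind_pmf (conv_power G \<mu> n) (\<lambda>g. map_pmf (\<lambda>h. x \<otimes> (g \<otimes> h)) \<mu>))"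
    using assms set_pmf_conv_power[OF assms, of n]
    by (intro bind_pmf_cong map_pmf_cong refl) (auto simp: subset_iff m_assoc)
  finally show ?case
    by (simp add: map_bind_pmf map_pmf_comp)
qed

text \<open>The length of the reduced image is itself a Markov chain: 2d - 2n letters are killed,
  and among the others only the inverse of the head shortens a nonempty word.\<close>

lemma sum_letters_kill_push:
  fixes \<phi> :: "nat \<Rightarrow> real"
  assumes "n \<le> d" "w \<in> words n"
  shows "(\<Sum>x\<in>letters d. \<phi> (length (kill n push x w))) =
    (2 * real d - 2 * real n) * \<phi> (length w) +
    (if w = [] then 2 * real n * \<phi> 1
     else \<phi> (length w - 1) + (2 * real n - 1) * \<phi> (length w + 1))"
proof -
  have sub: "letters n \<subseteq> letters d"
    using letters_restrict[OF assms(1)] by auto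
  have "(\<Sum>x\<in>letters d. \<phi> (length (kill n push x w))) =
      (\<Sum>x\<in>letters d - letters n. \<phi> (length (kill n push x w))) +
      (\<Sum>x\<in>letters n. \<phi> (length (kill n push x w)))"
    by (rule sum.subset_diff) (use sub in auto)
  also have "(\<Sum>x\<in>letters d - letters n. \<phi> (length (kill n push x w))) =
      (\<Sum>x\<in>letters d - letters n. \<phi> (length w))"
    by (rule sum.cong) (use letters_restrict[OF assms(1)] in \<open>auto simp: kill_def\<close>)
  also have "\<dots> = (2 * real d - 2 * real n) * \<phi> (length w)"
    using assms(1) sub by (simp add: card_Diff_subset card_letters of_nat_diff)
  also have "(\<Sum>x\<in>letters n. \<phi> (length (kill n push x w))) = (\<Sum>x\<in>letters n. \<phi> (length (push x w)))"
    by (rule sum.cong) (use letters_restrict[OF assms(1)] in \<open>auto simp: kill_def\<close>)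
  also have "\<dots> = (if w = [] then 2 * real n * \<phi> 1
     else \<phi> (length w - 1) + (2 * real n - 1) * \<phi> (length w + 1))"
  proof (cases "w = []")
    case True
    then show ?thesis by (simp add: push_def card_letters)
  next
    case False
    then have mem: "- hd w \<in> letters n"
      using assms(2) by (cases w) (auto simp: Cons_words)
    then have "n \<ge> 1" by (auto simp: letters_def)
    have "(\<Sum>x\<in>letters n. \<phi> (length (push x w))) =
        \<phi> (length (push (- hd w) w)) + (\<Sum>x\<in>letters n - {- hd w}. \<phi> (length (push x w)))"
      by (rule sum.remove) (use mem in auto)
    also have "(\<Sum>x\<in>letters n - {- hd w}. \<phi> (length (push x w))) =
        (\<Sum>x\<in>letters n - {- hd w}. \<phi> (length w + 1))"
      by (rule sum.cong) (auto simp: push_def)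
    also have "\<dots> = (2 * real n - 1) * \<phi> (length w + 1)"
      using mem \<open>n \<ge> 1\<close> by (simp add: card_letters of_nat_diff)
    finally show ?thesis using False by (simp add: push_def)
  qed
  finally show ?thesis .
qed

section \<open>Sizes of spheres and balls in the free group\<close>

lemma finite_words_length: "finite {w \<in> words n. length w = j}"
  by (rule finite_subset[OF _ finite_lists_length_eq[OF finite_letters[of n], of j]]) (auto simp: words_def)

lemma card_words_length_le:
  "card {w \<in> words n. length w = Suc j} \<le> 2 * n * (2 * n - 1) ^ j"
proof (induction j)
  case 0
  have "{w \<in> words n. length w = Suc 0} \<subseteq> (\<lambda>x. [x]) ` letters n"
    by (auto simp: length_Suc_conv Cons_words)
  from card_mono[OF _ this] card_image_le[of "letters n" "\<lambda>x. [x]"] show ?case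
    by (simp add: card_letters)
next
  case (Suc j)
  let ?W = "{w \<in> words n. length w = Suc j}"
  have "{w \<in> words n. length w = Suc (Suc j)} \<subseteq> (\<Union>w\<in>?W. (\<lambda>x. x # w) ` (letters n - {- hd w}))"
  proof
    fix w assume "w \<in> {w \<in> words n. length w = Suc (Suc j)}"
    then obtain x v where w: "w = x # v" "x \<in> letters n" "v \<in> ?W" "hd v \<noteq> - x"
      by (cases w) (auto simp: Cons_words)
    then show "w \<in> (\<Union>w\<in>?W. (\<lambda>x. x # w) ` (letters n - {- hd w}))"
      by (intro UN_I[of v]) auto
  qed
  then have "card {w \<in> words n. length w = Suc (Suc j)} \<le>
      card (\<Union>w\<in>?W. (\<lambda>x. x # w) ` (letters n - {- hd w}))"
    by (intro card_mono) (auto simp: finite_words_length)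
  also have "\<dots> \<le> (\<Sum>w\<in>?W. card ((\<lambda>x. x # w) ` (letters n - {- hd w})))"
    by (rule card_UN_le[OF finite_words_length])
  also have "\<dots> \<le> (\<Sum>w\<in>?W. 2 * n - 1)"
  proof (rule sum_mono)
    fix w assume "w \<in> ?W"
    then have "- hd w \<in> letters n" by (cases w) (auto simp: Cons_words)
    then have "card (letters n - {- hd w}) = 2 * n - 1" by (simp add: card_letters)
    then show "card ((\<lambda>x. x # w) ` (letters n - {- hd w})) \<le> 2 * n - 1"
      using card_image_le[of "letters n - {- hd w}" "\<lambda>x. x # w"] by simp
  qed
  also have "\<dots> = card ?W * (2 * n - 1)" by simp
  also have "\<dots> \<le> 2 * n * (2 * n - 1) ^ j * (2 * n - 1)"
    by (rule mult_right_mono[OF Suc]) simp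
  finally show ?case by (simp add: mult_ac)
qed

text \<open>Each sphere has weight at most 2, because 2n \<le> 2 (2n - 1), so the ball of radius m
  has weight linear in m. The logarithm of this bound is the sublinear error in the entropy.\<close>

lemma sum_words_powr_le:
  assumes "n \<ge> 1"
  shows "(\<Sum>w\<in>{w \<in> words n. length w \<le> m}. (1 / (2 * real n - 1)) ^ length w) \<le> 2 * real m + 2"
proof -
  let ?q = "2 * real n - 1"
  have q: "?q \<ge> 1" "real (2 * n - 1) = ?q" using assms by (auto simp: of_nat_diff)
  have le: "real (card {w \<in> words n. length w = j}) * (1 / ?q) ^ j \<le> 2" for j
  proof (cases j)
    case 0
    have "{w \<in> words n. length w = 0} = {[]}" by auto
    with 0 show ?thesis by simp
  next
    case (Suc i)
    have "real (card {w \<in> words n. length w = j}) \<le> real (2 * n * (2 * n - 1) ^ i)"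
      unfolding Suc by (rule of_nat_mono) (rule card_words_length_le)
    also have "\<dots> = 2 * real n * ?q ^ i" by (simp only: of_nat_mult of_nat_power q of_nat_numeral)
    also have "\<dots> \<le> 2 * ?q * ?q ^ i"
      using q(1) assms by (intro mult_right_mono) auto
    also have "\<dots> = 2 * ?q ^ j" by (simp add: Suc)
    finally have "real (card {w \<in> words n. length w = j}) * (1 / ?q) ^ j \<le> 2 * ?q ^ j * (1 / ?q) ^ j"
      by (rule mult_right_mono) (use q in auto)
    also have "\<dots> = 2" using assms by (simp add: power_one_over)
    finally show ?thesis .
  qed
  have "{w \<in> words n. length w \<le> m} = (\<Union>j\<in>{..m}. {w \<in> words n. length w = j})" by auto
  then have "(\<Sum>w\<in>{w \<in> words n. length w \<le> m}. (1 / ?q) ^ length w) =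
      (\<Sum>j\<le>m. \<Sum>w\<in>{w \<in> words n. length w = j}. (1 / ?q) ^ length w)"
    by (simp only:) (rule sum.UNION_disjoint, auto simp: finite_words_length)
  also have "\<dots> = (\<Sum>j\<le>m. real (card {w \<in> words n. length w = j}) * (1 / ?q) ^ j)"
    by (intro sum.cong refl) simp
  also have "\<dots> \<le> (\<Sum>j\<le>m. 2)" by (rule sum_mono) (rule le)
  finally show ?thesis by simp
qed

section \<open>The walk on the abstract group and its reduced images\<close>

locale free_walk = free_basis \<Gamma> a d
  for \<Gamma> :: "('g, 'm) monoid_scheme" (structure) and a d +
  assumes d_ge_2: "d \<ge> 2"
begin

text \<open>Drawing a letter first turns expectations into sums over \<open>letters d\<close>;
  \<open>\<mu>_eq\<close> identifies the result with the measure of the theorem.\<close>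

definition \<mu> :: "'g pmf" where
  "\<mu> = map_pmf gen (pmf_of_set (letters d))"

lemma letters_neq_empty: "letters d \<noteq> {}"
  using d_ge_2 card_letters[of d] by auto

lemma \<mu>_eq: "\<mu> = pmf_of_set (symmetric_set \<Gamma> {1..d} a)"
  using map_pmf_of_set_inj[OF inj_on_gen letters_neq_empty finite_letters]
  by (simp add: \<mu>_def gen_image_letters)

lemma set_pmf_\<mu>: "set_pmf \<mu> = gen ` letters d"
  using letters_neq_empty by (simp add: \<mu>_def)

lemma set_pmf_\<mu>_subset: "set_pmf \<mu> \<subseteq> carrier \<Gamma>"
  by (auto simp: set_pmf_\<mu>)

lemma words_action: "n \<le> d \<Longrightarrow> free_basis_action \<Gamma> a d (kill n push) (words n)"
  by unfold_locales (auto simp: kill_push_words kill_push_uminus)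

text \<open>The normal form of the image of g in the free group on the first n generators, obtained
  as a point of the orbit of the empty word.\<close>

definition red :: "nat \<Rightarrow> 'g \<Rightarrow> real list" where
  "red n g = letter_action (kill n push) (words n) g []"

lemma red_eq: "red n g = foldr (kill n push) (rep g) []"
  by (simp add: red_def letter_action_def)

lemma red_words: "n \<le> d \<Longrightarrow> g \<in> carrier \<Gamma> \<Longrightarrow> red n g \<in> words n"
  using free_basis_action.letter_action_closed[OF words_action] by (simp add: red_def)

lemma red_one: "n \<le> d \<Longrightarrow> red n \<one> = []"
  using free_basis_action.letter_action_one[OF words_action] by (simp add: red_def)

lemma red_gen_mult:
  "n \<le> d \<Longrightarrow> x \<in> letters d \<Longrightarrow> g \<in> carrier \<Gamma> \<Longrightarrow> red n (gen x \<otimes> g) = kill n push x (red n g)"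
  unfolding red_def
  by (simp add: free_basis_action.letter_action_mult[OF words_action]
      free_basis_action.letter_action_gen[OF words_action] free_basis_action.letter_action_closed[OF words_action])

text \<open>The product acts on \<open>[]\<close> as g acts on \<open>[x]\<close>, or on
  \<open>[]\<close> if x is killed. The walk grows on the right, so each step touches only the end
  of the reduced word; this is what lets prefixes converge.\<close>

lemma red_mult_gen:
  assumes "n \<le> d" "x \<in> letters d" "g \<in> carrier \<Gamma>"
  shows "red n (g \<otimes> gen x) =
    (if \<bar>x\<bar> \<le> real n then
       (if red n g \<noteq> [] \<and> last (red n g) = - x then butlast (red n g) else red n g @ [x])
     else red n g)"
proof (cases "\<bar>x\<bar> \<le> real n")
  case True
  then have x: "x \<in> letters n" using assms letters_restrict by auto
  then have "[x] \<in> words n" by (simp add: Cons_words)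
  have "red n (g \<otimes> gen x) = letter_action (kill n push) (words n) g [x]"
    unfolding red_def using assms True
    by (simp add: free_basis_action.letter_action_mult[OF words_action]
      free_basis_action.letter_action_gen[OF words_action]) (simp add: kill_def push_def)
  also have "\<dots> = foldr push (red n g) [x]"
    using \<open>[x] \<in> words n\<close> assms rep(1)[of g]
      foldr_kill[where S = "words n" and T = push and n = n and d = d and w = "rep g" and s = "[x]",
        OF push_words push_uminus_push]
    by (simp add: letter_action_def red_eq)
  finally show ?thesis
    using True foldr_push_singleton[OF red_words[OF assms(1,3)], of x] by simp
next
  case False
  then show ?thesis
    unfolding red_def using assms
    by (simp add: free_basis_action.letter_action_mult[OF words_action]
      free_basis_action.letter_action_gen[OF words_action]) (simp add: kill_def)
qed

text \<open>With all d generators kept no information is lost; in particular \<open>red d\<close> is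
  injective on the carrier.\<close>

lemma ev_red: "g \<in> carrier \<Gamma> \<Longrightarrow> ev (red d g) = g"
proof -
  have "ev (foldr (kill d push) w []) = ev w \<and> set (foldr (kill d push) w []) \<subseteq> letters d"
    if "set w \<subseteq> letters d" for w
    using that
  proof (induction w)
    case (Cons x w)
    then have "foldr (kill d push) w [] \<in> words d"
      using free_basis_action.foldr_closed[OF words_action, of d w "[]"] by simp
    moreover have "\<bar>x\<bar> \<le> real d" using Cons.prems letters_restrict[of d d] by auto
    ultimately show ?case
      using Cons push_words[of x d "foldr (kill d push) w []"]
      by (simp add: kill_def[of d push x] ev_push words_def)
  qed auto
  then show "g \<in> carrier \<Gamma> \<Longrightarrow> ev (red d g) = g"
    using rep by (simp add: red_eq)
qed

lemma countable_carrier: "countable (carrier \<Gamma>)"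
proof -
  have "carrier \<Gamma> \<subseteq> ev ` lists (letters d)"
    using ev_surj by (force simp: in_lists_conv_set)
  then show ?thesis
    using countable_subset countable_image countable_lists countable_finite finite_letters by metis
qed

abbreviation walk_pmf :: "nat \<Rightarrow> 'g pmf" where
  "walk_pmf \<equiv> conv_power \<Gamma> \<mu>"

lemmas set_pmf_walk_pmf = set_pmf_conv_power[OF set_pmf_\<mu>_subset]

lemma finite_walk_pmf: "finite (set_pmf (walk_pmf m))"
  by (induction m) (auto simp: set_pmf_\<mu>)

lemma expectation_walk_pmf_Suc:
  fixes f :: "'g \<Rightarrow> real"
  shows "measure_pmf.expectation (walk_pmf (Suc m)) f =
    (\<Sum>x\<in>letters d. measure_pmf.expectation (walk_pmf m) (\<lambda>g. f (gen x \<otimes> g))) / (2 * real d)"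
proof -
  have "walk_pmf (Suc m) = pmf_of_set (letters d) \<bind> (\<lambda>x. map_pmf (\<lambda>g. gen x \<otimes> g) (walk_pmf m))"
    unfolding conv_power_Suc_left[OF set_pmf_\<mu>_subset] by (simp add: \<mu>_def bind_map_pmf)
  then have "measure_pmf.expectation (walk_pmf (Suc m)) f =
      (\<Sum>x\<in>letters d. measure_pmf.expectation (map_pmf (\<lambda>g. gen x \<otimes> g) (walk_pmf m)) f /\<^sub>R
        real (card (letters d)))"
    using pmf_expectation_bind_pmf_of_set[OF letters_neq_empty finite_letters,
        of "\<lambda>x. map_pmf (\<lambda>g. gen x \<otimes> g) (walk_pmf m)" f] finite_walk_pmf by (simp only: set_map_pmf) blast
  moreover have "c /\<^sub>R real (2 * d) = c / (2 * real d)" for c :: real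
    by (simp only: real_scaleR_def of_nat_mult of_nat_numeral divide_inverse mult.commute)
  ultimately show ?thesis
    by (simp only: integral_map_pmf card_letters sum_divide_distrib)
qed

lemma integrable_walk_pmf: "integrable (walk_pmf m) (f :: 'g \<Rightarrow> real)"
  by (rule integrable_measure_pmf_finite[OF finite_walk_pmf])

lemma expectation_length_Suc:
  fixes \<phi> :: "nat \<Rightarrow> real"
  assumes "n \<le> d"
  shows "measure_pmf.expectation (walk_pmf (Suc m)) (\<lambda>g. \<phi> (length (red n g))) =
    measure_pmf.expectation (walk_pmf m) (\<lambda>g. (\<Sum>x\<in>letters d. \<phi> (length (kill n push x (red n g)))) / (2 * real d))"
proof -
  have "measure_pmf.expectation (walk_pmf m) (\<lambda>g. \<phi> (length (red n (gen x \<otimes> g)))) =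
      measure_pmf.expectation (walk_pmf m) (\<lambda>g. \<phi> (length (kill n push x (red n g))))"
    if "x \<in> letters d" for x
    using that set_pmf_walk_pmf assms
    by (intro integral_cong_AE) (auto simp: AE_measure_pmf_iff red_gen_mult subset_iff)
  then show ?thesis
    by (subst expectation_walk_pmf_Suc) (simp add: integrable_walk_pmf)
qed

section \<open>Exponential decay of the probability of short words\<close>

text \<open>Simple random walk on the free group of rank n has spectral radius sqrt (2n - 1) / n;
  resting with probability (d - n) / d turns it into this value.\<close>

definition spectral :: "nat \<Rightarrow> real" where
  "spectral n = (real d - real n + sqrt (2 * real n - 1)) / real d"

lemma spectral_nonneg: "1 \<le> n \<Longrightarrow> n \<le> d \<Longrightarrow> 0 \<le> spectral n"
  by (simp add: spectral_def)

lemma spectral_less_one: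
  assumes "2 \<le> n" "n \<le> d"
  shows "spectral n < 1"
proof -
  have "2 * real n - 1 < real n ^ 2"
    using zero_less_power[of "real n - 1" 2] assms by (simp add: power2_eq_square algebra_simps)
  then have "sqrt (2 * real n - 1) < real n" by (rule real_less_lsqrt[rotated 1]) simp
  then show ?thesis using assms by (simp add: spectral_def)
qed

text \<open>One step multiplies the mean of r^|w| by at most \<open>spectral n\<close>. The base r =
  1 / sqrt (2n - 1) is the one that minimizes 1 / r + (2n - 1) r, the growth factor at nonempty
  words.\<close>

lemma expectation_power_length_le:
  assumes "1 \<le> n" "n \<le> d"
  shows "measure_pmf.expectation (walk_pmf m) (\<lambda>g. (1 / sqrt (2 * real n - 1)) ^ length (red n g)) \<le> spectral n ^ m"
proof (induction m)
  case 0
  then show ?case using assms by (simp add: red_one)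
next
  case (Suc m)
  define s where "s = sqrt (2 * real n - 1)"
  define r where "r = 1 / s"
  have s: "s > 0" "s * s = 2 * real n - 1" using assms by (auto simp: s_def)
  have n: "real n \<ge> 1" using assms by simp
  have le: "(\<Sum>x\<in>letters d. r ^ length (kill n push x w)) / (2 * real d) \<le> spectral n * r ^ length w"
    if "w \<in> words n" for w
  proof -
    have "(\<Sum>x\<in>letters d. r ^ length (kill n push x w)) \<le>
        (2 * real d - 2 * real n) * r ^ length w + 2 * s * r ^ length w"
    proof (cases w)
      case Nil
      \<comment> \<open>At the empty word all 2n surviving letters lengthen; the estimate amounts to
        n \<le> 2n - 1.\<close>
      have "2 * real n * r \<le> 2 * s"
        using s n by (simp add: r_def field_simps)
      then show ?thesis
        unfolding sum_letters_kill_push[OF assms(2) that, of "power r"] using Nil by simp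
    next
      case (Cons y v)
      have "1 + (2 * real n - 1) * r * r = 2 * s * r"
        using s by (simp add: r_def field_simps)
      then have "r ^ length v + (2 * real n - 1) * (r * (r * r ^ length v)) = 2 * s * (r * r ^ length v)"
        by (metis (no_types, opaque_lifting) mult.assoc mult.commute mult.left_neutral ring_class.ring_distribs(2))
      then show ?thesis
        unfolding sum_letters_kill_push[OF assms(2) that, of "power r"] using Cons by simp
    qed
    also have "\<dots> = 2 * real d * (spectral n * r ^ length w)"
      using d_ge_2 by (simp add: spectral_def s_def field_simps)
    finally show ?thesis using d_ge_2 by (simp add: field_simps)
  qed
  have "measure_pmf.expectation (walk_pmf (Suc m)) (\<lambda>g. r ^ length (red n g)) =
      measure_pmf.expectation (walk_pmf m) (\<lambda>g. (\<Sum>x\<in>letters d. r ^ length (kill n push x (red n g))) / (2 * real d))"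
    by (rule expectation_length_Suc[OF assms(2)])
  also have "\<dots> \<le> measure_pmf.expectation (walk_pmf m) (\<lambda>g. spectral n * r ^ length (red n g))"
    using set_pmf_walk_pmf red_words[OF assms(2)] le
    by (intro integral_mono_AE integrable_walk_pmf) (auto simp: AE_measure_pmf_iff subset_iff)
  also have "\<dots> \<le> spectral n * spectral n ^ m"
    using Suc spectral_nonneg[OF assms] unfolding r_def s_def
    by (simp add: mult_left_mono)
  finally show ?case by (simp add: r_def s_def)
qed

text \<open>Markov's inequality: s^j (1 / s)^|w| dominates the indicator of length at most
  j.\<close>

lemma prob_length_le:
  assumes "1 \<le> n" "n \<le> d"
  shows "measure_pmf.prob (walk_pmf m) {g. length (red n g) \<le> j} \<le> sqrt (2 * real n - 1) ^ j * spectral n ^ m"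
proof -
  define s where "s = sqrt (2 * real n - 1)"
  have s: "s \<ge> 1" using assms by (simp add: s_def)
  have "measure_pmf.prob (walk_pmf m) {g. length (red n g) \<le> j} =
      measure_pmf.expectation (walk_pmf m) (indicator {g. length (red n g) \<le> j})"
    by simp
  also have "\<dots> \<le> measure_pmf.expectation (walk_pmf m) (\<lambda>g. s ^ j * (1 / s) ^ length (red n g))"
  proof (rule integral_mono[OF integrable_walk_pmf integrable_walk_pmf])
    fix g
    have "s ^ length (red n g) \<le> s ^ j" if "length (red n g) \<le> j"
      using s that by (rule power_increasing[rotated])
    then show "indicator {g. length (red n g) \<le> j} g \<le> s ^ j * (1 / s) ^ length (red n g)"
      using s by (auto simp: indicator_def power_one_over field_simps)
  qed
  also have "\<dots> \<le> s ^ j * spectral n ^ m"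
    using expectation_power_length_le[OF assms, of m] s by (simp add: s_def mult_left_mono)
  finally show ?thesis by (simp add: s_def)
qed

end

section \<open>The entropy of the random walk\<close>

context free_walk
begin

lemma length_red_walk_pmf:
  assumes "n \<le> d" "g \<in> set_pmf (walk_pmf m)"
  shows "length (red n g) \<le> m"
  using assms(2)
proof (induction m arbitrary: g)
  case 0
  then show ?case using assms(1) by (simp add: red_one)
next
  case (Suc m)
  then obtain x h where xh: "x \<in> letters d" "h \<in> set_pmf (walk_pmf m)" "g = gen x \<otimes> h"
    unfolding conv_power_Suc_left[OF set_pmf_\<mu>_subset] by (auto simp: set_pmf_\<mu>)
  then have "h \<in> carrier \<Gamma>" using set_pmf_walk_pmf by blast
  then have "red n g = kill n push x (red n h)"
    using xh assms(1) by (simp add: red_gen_mult)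
  moreover have "length (kill n push x w) \<le> Suc (length w)" for w
    by (auto simp: kill_def push_def)
  ultimately show ?case using Suc.IH[OF xh(2)] by (metis Suc_le_mono order_trans)
qed

text \<open>The bound decays like the Green function of the walk, which is why it is superharmonic.\<close>

lemma pmf_walk_pmf_le:
  assumes "g \<in> carrier \<Gamma>"
  shows "pmf (walk_pmf m) g \<le> (1 / (2 * real d - 1)) ^ length (red d g)"
  using assms
proof (induction m arbitrary: g)
  case 0
  then show ?case
    using d_ge_2 by (cases "g = \<one>") (simp_all add: red_one)
next
  case (Suc m)
  define r where "r = 1 / (2 * real d - 1)"
  \<comment> \<open>The last identity says that r^|w| is harmonic away from the empty word; there, r
    \<le> 1 suffices.\<close>
  have r: "r > 0" "r \<le> 1" "1 + (2 * real d - 1) * r * r = 2 * real d * r"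
    using d_ge_2 by (auto simp: r_def field_simps)
  let ?w = "red d g"
  have w: "?w \<in> words d" using Suc.prems by (simp add: red_words)
  have "pmf (walk_pmf (Suc m)) g = measure_pmf.expectation (walk_pmf (Suc m)) (indicator {g})"
    by (simp add: pmf.rep_eq del: conv_power.simps)
  also have "\<dots> = (\<Sum>x\<in>letters d. measure_pmf.expectation (walk_pmf m) (\<lambda>h. indicator {g} (gen x \<otimes> h))) / (2 * real d)"
    by (rule expectation_walk_pmf_Suc)
  also have "(\<Sum>x\<in>letters d. measure_pmf.expectation (walk_pmf m) (\<lambda>h. indicator {g} (gen x \<otimes> h))) =
      (\<Sum>x\<in>letters d. pmf (walk_pmf m) (gen (- x) \<otimes> g))"
  proof (rule sum.cong[OF refl])
    fix x assume x: "x \<in> letters d"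
    have "indicator {g} (gen x \<otimes> h) = (indicator {gen (- x) \<otimes> g} h :: real)" if "h \<in> carrier \<Gamma>" for h
      using gen_cancel[OF x that] gen_cancel[of "- x" g] x Suc.prems by (auto simp: indicator_def)
    then have "measure_pmf.expectation (walk_pmf m) (\<lambda>h. indicator {g} (gen x \<otimes> h) :: real) =
        measure_pmf.expectation (walk_pmf m) (indicator {gen (- x) \<otimes> g})"
      using set_pmf_walk_pmf by (intro integral_cong_AE) (auto simp: AE_measure_pmf_iff subset_iff)
    then show "measure_pmf.expectation (walk_pmf m) (\<lambda>h. indicator {g} (gen x \<otimes> h) :: real) =
        pmf (walk_pmf m) (gen (- x) \<otimes> g)"
      by (simp add: pmf.rep_eq)
  qed
  also have "\<dots> = (\<Sum>x\<in>letters d. pmf (walk_pmf m) (gen x \<otimes> g))"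
    by (rule sum.reindex_bij_witness[of _ uminus uminus]) auto
  also have "\<dots> \<le> (\<Sum>x\<in>letters d. r ^ length (red d (gen x \<otimes> g)))"
    unfolding r_def by (intro sum_mono Suc.IH) (use Suc.prems in auto)
  also have "\<dots> = (\<Sum>x\<in>letters d. r ^ length (kill d push x ?w))"
    by (intro sum.cong refl) (use Suc.prems in \<open>simp add: red_gen_mult\<close>)
  also have "\<dots> \<le> 2 * real d * r ^ length ?w"
  proof (cases ?w)
    case Nil
    have "2 * real d * r \<le> 2 * real d * 1"
      using r by (intro mult_left_mono) auto
    then show ?thesis
      unfolding sum_letters_kill_push[OF order.refl w, of "power r"] using Nil by simp
  next
    case (Cons y v)
    have "r ^ length v + (2 * real d - 1) * (r * (r * r ^ length v)) =
        (1 + (2 * real d - 1) * r * r) * r ^ length v"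
      by (simp add: algebra_simps)
    also have "\<dots> = 2 * real d * (r * r ^ length v)"
      by (metis mult.assoc r(3))
    finally show ?thesis
      unfolding sum_letters_kill_push[OF order.refl w, of "power r"] using Cons by simp
  qed
  finally show ?case
    using d_ge_2 by (simp add: r_def field_simps)
qed

section \<open>The speed of the walk\<close>

definition mean_length :: "nat \<Rightarrow> real" where
  "mean_length m = measure_pmf.expectation (walk_pmf m) (\<lambda>g. real (length (red d g)))"

text \<open>Away from the identity the expected gain is (2d - 2) / (2d); at the identity it is 1,
  that is 1 / d more.\<close>

lemma mean_length_Suc:
  "mean_length (Suc m) = mean_length m + (real d - 1) / real d +
    measure_pmf.prob (walk_pmf m) {g. length (red d g) \<le> 0} / real d"
proof -
  have "mean_length (Suc m) = measure_pmf.expectation (walk_pmf m)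
      (\<lambda>g. (\<Sum>x\<in>letters d. real (length (kill d push x (red d g)))) / (2 * real d))"
    unfolding mean_length_def by (rule expectation_length_Suc) simp
  also have "\<dots> = measure_pmf.expectation (walk_pmf m)
      (\<lambda>g. real (length (red d g)) + (real d - 1) / real d + indicator {g. length (red d g) \<le> 0} g / real d)"
  proof (rule integral_cong_AE)
    have "(\<Sum>x\<in>letters d. real (length (kill d push x w))) / (2 * real d) =
        real (length w) + (real d - 1) / real d + (if w = [] then 1 else 0) / real d"
      if "w \<in> words d" for w
      unfolding sum_letters_kill_push[OF order.refl that, of real]
      using d_ge_2 by (cases w) (auto simp: field_simps)
    then show "AE g in walk_pmf m. (\<Sum>x\<in>letters d. real (length (kill d push x (red d g)))) / (2 * real d) =
        real (length (red d g)) + (real d - 1) / real d + indicator {g. length (red d g) \<le> 0} g / real d"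
      using set_pmf_walk_pmf red_words[of d] by (auto simp: AE_measure_pmf_iff subset_iff indicator_def)
  qed auto
  also have "\<dots> = mean_length m + (real d - 1) / real d +
      measure_pmf.prob (walk_pmf m) {g. length (red d g) \<le> 0} / real d"
    by (simp add: integrable_walk_pmf mean_length_def)
  finally show ?thesis .
qed

text \<open>The surplus arises only on returns to the identity, whose probabilities are dominated by
  a geometric series in \<open>spectral d\<close>.\<close>

lemma mean_length_bounds:
  "real m * ((real d - 1) / real d) \<le> mean_length m"
  "mean_length m \<le> real m * ((real d - 1) / real d) + 1 / (1 - spectral d)"
proof -
  have sp: "0 \<le> spectral d" "spectral d < 1"
    using d_ge_2 by (auto simp: spectral_nonneg spectral_less_one)
  have "real m * ((real d - 1) / real d) \<le> mean_length m \<and>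
      mean_length m \<le> real m * ((real d - 1) / real d) + (\<Sum>j<m. spectral d ^ j)"
  proof (induction m)
    case 0
    show ?case by (simp add: mean_length_def red_one)
  next
    case (Suc m)
    let ?p = "measure_pmf.prob (walk_pmf m) {g. length (red d g) \<le> 0}"
    have "?p \<le> spectral d ^ m"
      using prob_length_le[of d m 0] d_ge_2 by simp
    moreover have "?p / real d \<le> ?p / 1"
      using d_ge_2 by (intro divide_left_mono) auto
    moreover have "0 \<le> ?p / real d" by simp
    ultimately show ?case
      using Suc unfolding mean_length_Suc of_nat_Suc sum.lessThan_Suc distrib_right by linarith
  qed
  moreover have "(\<Sum>j<m. spectral d ^ j) \<le> 1 / (1 - spectral d)"
    using sp by (simp add: sum_gp_strict divide_right_mono)
  ultimately show "real m * ((real d - 1) / real d) \<le> mean_length m"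
    "mean_length m \<le> real m * ((real d - 1) / real d) + 1 / (1 - spectral d)"
    by linarith+
qed

section \<open>Shannon entropy against mean length\<close>

lemma shannon_entropy_eq_sum:
  assumes "finite (set_pmf p)"
  shows "shannon_entropy p = (\<Sum>g\<in>set_pmf p. - ln (pmf p g) * pmf p g)"
proof -
  have "shannon_entropy p = (\<Sum>\<^sub>\<infinity>g\<in>set_pmf p. - ln (pmf p g) * pmf p g)"
    unfolding shannon_entropy_def by (rule infsum_cong_neutral) (auto simp: set_pmf_iff)
  then show ?thesis using assms by simp
qed

lemma expectation_eq_sum:
  "finite (set_pmf p) \<Longrightarrow> measure_pmf.expectation p f = (\<Sum>g\<in>set_pmf p. f g * pmf p g)"
  for f :: "_ \<Rightarrow> real"
  by (subst integral_measure_pmf[where A = "set_pmf p"]) (auto simp: mult.commute)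

text \<open>Below: the law is pointwise at most the weight (2d - 1)^(-|g|). Above: entropy is at
  most cross entropy against the same weight, whose total on the ball of radius m is at most 2m +
  2.\<close>

lemma shannon_entropy_walk_bounds:
  "ln (2 * real d - 1) * mean_length m \<le> shannon_entropy (walk_pmf m)"
  "shannon_entropy (walk_pmf m) \<le> ln (2 * real d - 1) * mean_length m + ln (2 * real m + 2)"
proof -
  define q where "q = 2 * real d - 1"
  define p where "p = walk_pmf m"
  define r where "r g = (1 / q) ^ length (red d g)" for g
  have q: "q > 1" using d_ge_2 by (simp add: q_def)
  have fin: "finite (set_pmf p)" by (simp add: p_def finite_walk_pmf)
  have sub: "set_pmf p \<subseteq> carrier \<Gamma>" unfolding p_def by (rule set_pmf_walk_pmf)
  have r: "r g > 0" "- ln (r g) = ln q * real (length (red d g))" for g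
    using q by (auto simp: r_def ln_realpow ln_div)
  have mean: "ln q * mean_length m = (\<Sum>g\<in>set_pmf p. - ln (r g) * pmf p g)"
    unfolding mean_length_def r(2) using fin
    by (simp add: p_def expectation_eq_sum sum_distrib_left mult.assoc)
  have pos: "pmf p g > 0" if "g \<in> set_pmf p" for g
    using that by (simp add: pmf_positive)
  have "ln q * mean_length m \<le> shannon_entropy p"
    unfolding shannon_entropy_eq_sum[OF fin] mean
  proof (rule sum_mono, rule mult_right_mono)
    fix g assume g: "g \<in> set_pmf p"
    then have "pmf p g \<le> r g"
      using pmf_walk_pmf_le[of g m] sub by (auto simp: p_def r_def q_def)
    then show "- ln (r g) \<le> - ln (pmf p g)"
      using pos[OF g] by simp
  qed simp
  then show "ln (2 * real d - 1) * mean_length m \<le> shannon_entropy (walk_pmf m)"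
    by (simp add: p_def q_def)
  have "(\<Sum>g\<in>set_pmf p. r g) = (\<Sum>w\<in>red d ` set_pmf p. (1 / q) ^ length w)"
  proof (subst sum.reindex)
    show "inj_on (red d) (set_pmf p)"
      using ev_red sub by (intro inj_on_inverseI[of _ ev]) auto
  qed (simp add: r_def)
  also have "\<dots> \<le> (\<Sum>w\<in>{w \<in> words d. length w \<le> m}. (1 / q) ^ length w)"
  proof (rule sum_mono2)
    have "{w \<in> words d. length w \<le> m} = (\<Union>j\<le>m. {w \<in> words d. length w = j})" by auto
    then show "finite {w \<in> words d. length w \<le> m}" by (simp add: finite_words_length)
    show "red d ` set_pmf p \<subseteq> {w \<in> words d. length w \<le> m}"
      using sub by (auto simp: red_words p_def length_red_walk_pmf)
  qed (use q in auto)
  also have "\<dots> \<le> 2 * real m + 2"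
    unfolding q_def using d_ge_2 by (intro sum_words_powr_le) simp
  finally have Z: "(\<Sum>g\<in>set_pmf p. r g) \<le> 2 * real m + 2" .
  define Z where "Z = 2 * real m + 2"
  have "Z > 0" by (simp add: Z_def)
  \<comment> \<open>Gibbs' inequality for the weights \<open>r g / Z\<close>\<close>
  have "ln (r g / Z / pmf p g) = ln (r g) - ln Z - ln (pmf p g)" if "g \<in> set_pmf p" for g
    using pos[OF that] r(1)[of g] \<open>Z > 0\<close> by (simp add: ln_div ln_mult del: divide_divide_eq_left)
  then have "shannon_entropy p - (\<Sum>g\<in>set_pmf p. (- ln (r g) + ln Z) * pmf p g) =
      (\<Sum>g\<in>set_pmf p. ln (r g / Z / pmf p g) * pmf p g)"
    unfolding shannon_entropy_eq_sum[OF fin] sum_subtractf[symmetric]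
    by (intro sum.cong refl) (simp only:, simp add: algebra_simps)
  also have "\<dots> \<le> (\<Sum>g\<in>set_pmf p. r g / Z - pmf p g)"
  proof (rule sum_mono)
    fix g assume g: "g \<in> set_pmf p"
    have "ln (r g / Z / pmf p g) * pmf p g \<le> (r g / Z / pmf p g - 1) * pmf p g"
      using pos[OF g] r(1)[of g] \<open>Z > 0\<close> by (intro mult_right_mono ln_le_minus_one) auto
    also have "\<dots> = r g / Z - pmf p g" using pos[OF g] by (simp add: field_simps)
    finally show "ln (r g / Z / pmf p g) * pmf p g \<le> r g / Z - pmf p g" .
  qed
  also have "\<dots> = (\<Sum>g\<in>set_pmf p. r g) / Z - 1"
    using sum_pmf_eq_1[OF fin order.refl] by (simp add: sum_subtractf sum_divide_distrib)
  also have "\<dots> \<le> 0" using Z \<open>Z > 0\<close> by (simp add: Z_def)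
  finally have "shannon_entropy p \<le> (\<Sum>g\<in>set_pmf p. (- ln (r g) + ln Z) * pmf p g)" by simp
  also have "\<dots> = ln q * mean_length m + ln Z"
    unfolding mean using sum_pmf_eq_1[OF fin order.refl]
    by (simp add: distrib_right sum.distrib sum_subtractf left_diff_distrib sum_negf flip: sum_distrib_left)
  finally show "shannon_entropy (walk_pmf m) \<le> ln (2 * real d - 1) * mean_length m + ln (2 * real m + 2)"
    by (simp add: p_def q_def Z_def)
qed

lemma rw_entropy_eq: "rw_entropy \<Gamma> \<mu> = (real d - 1) / real d * ln (2 * real d - 1)"
proof -
  define c where "c = (real d - 1) / real d"
  define L where "L = ln (2 * real d - 1)"
  define K where "K = 1 / (1 - spectral d)"
  have L: "L \<ge> 0" using d_ge_2 by (simp add: L_def)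
  have "(\<lambda>m. shannon_entropy (walk_pmf m) / real m) \<longlonglongrightarrow> c * L"
  proof (rule tendsto_sandwich)
    show "\<forall>\<^sub>F m in sequentially. c * L \<le> shannon_entropy (walk_pmf m) / real m"
    proof (rule eventually_sequentiallyI)
      fix m :: nat assume "m \<ge> 1"
      have "L * (real m * c) \<le> L * mean_length m"
        using L mean_length_bounds(1)[of m] unfolding c_def by (rule mult_left_mono[rotated])
      also have "\<dots> \<le> shannon_entropy (walk_pmf m)"
        unfolding L_def by (rule shannon_entropy_walk_bounds)
      finally show "c * L \<le> shannon_entropy (walk_pmf m) / real m"
        using \<open>m \<ge> 1\<close> by (simp add: field_simps)
    qed
    show "\<forall>\<^sub>F m in sequentially. shannon_entropy (walk_pmf m) / real m \<le>
        c * L + (L * K + ln (2 * real m + 2)) / real m"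
    proof (rule eventually_sequentiallyI)
      fix m :: nat assume "m \<ge> 1"
      have "shannon_entropy (walk_pmf m) \<le> L * mean_length m + ln (2 * real m + 2)"
        unfolding L_def by (rule shannon_entropy_walk_bounds)
      also have "\<dots> \<le> L * (real m * c + K) + ln (2 * real m + 2)"
        using L mean_length_bounds(2)[of m] unfolding c_def K_def
        by (intro add_right_mono mult_left_mono)
      finally show "shannon_entropy (walk_pmf m) / real m \<le>
          c * L + (L * K + ln (2 * real m + 2)) / real m"
        using \<open>m \<ge> 1\<close> by (simp add: field_simps)
    qed
    show "(\<lambda>m. c * L + (L * K + ln (2 * real m + 2)) / real m) \<longlonglongrightarrow> c * L"
      by real_asymp
  qed simp
  then show ?thesis
    unfolding rw_entropy_def c_def L_def by (rule limI)
qed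

end

section \<open>The uniform measure on the space of rays\<close>

definition ray_space :: "nat \<Rightarrow> point topology" where
  "ray_space n = top_of_set (rays n)"

definition cylinder :: "nat \<Rightarrow> real list \<Rightarrow> point set" where
  "cylinder n w = {\<xi> \<in> rays n. \<forall>i<length w. \<xi> i = w ! i}"

lemma topspace_ray_space [simp]: "topspace (ray_space n) = rays n"
  by (simp add: ray_space_def)

lemma closed_rays: "closed (rays n)"
proof -
  \<comment> \<open>Admissible pairs of consecutive letters form a finite, hence closed,
    set.\<close>
  define P where "P = {p \<in> letters n \<times> letters n. snd p \<noteq> - fst p}"
  have "finite P" by (rule finite_subset[of _ "letters n \<times> letters n"]) (auto simp: P_def)
  then have "closed P" by (rule finite_imp_closed)
  have "continuous_on UNIV (\<lambda>\<xi> :: point. (\<xi> i, \<xi> (Suc i)))" for i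
    by (intro continuous_on_Pair continuous_on_product_coordinates)
  then have "closed ((\<lambda>\<xi> :: point. (\<xi> i, \<xi> (Suc i))) -` P)" for i
    using \<open>closed P\<close> by (rule closed_vimage[rotated])
  then have "closed (\<Inter>i. (\<lambda>\<xi> :: point. (\<xi> i, \<xi> (Suc i))) -` P)" by blast
  also have "(\<Inter>i. (\<lambda>\<xi> :: point. (\<xi> i, \<xi> (Suc i))) -` P) = rays n"
    by (auto simp: rays_def P_def)
  finally show ?thesis .
qed

lemma compact_rays: "compact (rays n)"
proof -
  have "compactin (product_topology (\<lambda>_ :: nat. euclidean) UNIV) (PiE UNIV (\<lambda>_. letters n))"
    by (simp add: compactin_PiE finite_imp_compact)
  then have "compact (PiE (UNIV :: nat set) (\<lambda>_. letters n))"
    by (simp add: euclidean_product_topology)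
  then have "compact (PiE UNIV (\<lambda>_. letters n) \<inter> rays n)"
    using closed_rays by (rule compact_Int_closed)
  moreover have "PiE UNIV (\<lambda>_. letters n) \<inter> rays n = rays n"
    by (auto simp: rays_def)
  ultimately show ?thesis by simp
qed

lemma compact_space_ray_space: "compact_space (ray_space n)"
  using compact_rays by (simp add: ray_space_def compact_space_subtopology)

lemma metrizable_space_ray_space: "metrizable_space (ray_space n)"
  unfolding ray_space_def by (intro metrizable_space_subtopology metrizable_space_euclidean)

lemma open_coordinates: "open A \<Longrightarrow> open {\<xi> :: point. \<xi> i \<in> A}"
  using open_vimage[of A "\<lambda>\<xi> :: point. \<xi> i"] by (simp add: vimage_def)

text \<open>Coordinates of rays take finitely many values, so any condition on one coordinate only
  excludes a finite set of letters, and this is an open condition.\<close>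

lemma openin_ray_space_coordinate: "openin (ray_space n) {\<xi> \<in> rays n. \<xi> i \<in> A}"
proof -
  have "{\<xi> \<in> rays n. \<xi> i \<in> A} = rays n \<inter> {\<xi>. \<xi> i \<in> - (letters n - A)}"
    by (auto simp: rays_def)
  moreover have "open (- (letters n - A))"
    by (intro open_Compl finite_imp_closed) simp
  ultimately show ?thesis
    unfolding ray_space_def by (simp only: openin_open_Int open_coordinates)
qed

lemma openin_cylinder: "openin (ray_space n) (cylinder n w)"
proof -
  have "openin (ray_space n) {\<xi> \<in> rays n. \<forall>i<m. \<xi> i = w ! i}" for m
  proof (induction m)
    case 0
    show ?case using openin_topspace[of "ray_space n"] by simp
  next
    case (Suc m)
    have "{\<xi> \<in> rays n. \<forall>i<Suc m. \<xi> i = w ! i} =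
        {\<xi> \<in> rays n. \<forall>i<m. \<xi> i = w ! i} \<inter> {\<xi> \<in> rays n. \<xi> m \<in> {w ! m}}"
      by (auto simp: less_Suc_eq)
    then show ?case
      using Suc openin_ray_space_coordinate[of n m "{w ! m}"] by (simp only: openin_Int)
  qed
  then show ?thesis by (simp add: cylinder_def)
qed

lemma prefix_words: "\<xi> \<in> rays n \<Longrightarrow> map \<xi> [0..<m] \<in> words n"
proof (induction m)
  case (Suc m)
  then have "\<xi> m \<in> letters n" by (simp add: rays_def)
  moreover have "\<xi> m \<noteq> - last (map \<xi> [0..<m])" if "m > 0"
    using that Suc.prems by (cases m) (auto simp: rays_def)
  ultimately show ?case
    using Suc by (cases "m = 0") (auto simp: append_words Cons_words)
qed simp

text \<open>A basic open set of the product restricts finitely many coordinates. Quantifying over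
  all k \<ge> m allows the prefix to be lengthened, as the length bound in \<open>cylinders\<close>
  demands.\<close>

lemma ray_space_neighbourhood:
  assumes "openin (ray_space n) U" "\<xi> \<in> U"
  shows "\<exists>m. \<forall>k\<ge>m. cylinder n (map \<xi> [0..<k]) \<subseteq> U"
proof -
  obtain V where V: "open V" "U = rays n \<inter> V"
    using assms(1) by (auto simp: ray_space_def openin_open)
  then have "openin (product_topology (\<lambda>_ :: nat. euclideanreal) UNIV) V"
    by (simp add: euclidean_product_topology)
  moreover have "\<xi> \<in> V" using assms(2) V by simp
  ultimately obtain W where W: "\<xi> \<in> (\<Pi>\<^sub>E i\<in>UNIV. W i)"
      "finite {i. W i \<noteq> (UNIV :: real set)}" "(\<Pi>\<^sub>E i\<in>UNIV. W i) \<subseteq> V"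
    using product_topology_open_contains_basis[of "\<lambda>_. euclideanreal" UNIV V \<xi>] by auto
  obtain m where m: "\<And>i. W i \<noteq> UNIV \<Longrightarrow> i < m"
    using finite_nat_set_iff_bounded[THEN iffD1, OF W(2)] by auto
  have "\<eta> \<in> U" if "m \<le> k" "\<eta> \<in> cylinder n (map \<xi> [0..<k])" for \<eta> k
  proof -
    have "\<eta> i \<in> W i" for i
    proof (cases "W i = UNIV")
      case False
      then have "\<eta> i = \<xi> i" using that m[of i] by (simp add: cylinder_def)
      then show ?thesis using W(1) by auto
    qed simp
    then show ?thesis using W(3) V(2) that(2) by (auto simp: cylinder_def)
  qed
  then show ?thesis by blast
qed

lemma cylinder_subset_rays: "cylinder n w \<subseteq> rays n"
  by (auto simp: cylinder_def)

lemma cylinder_prefix: "\<xi> \<in> rays n \<Longrightarrow> \<xi> \<in> cylinder n (map \<xi> [0..<m])"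
  by (simp add: cylinder_def)

lemma countable_words: "countable (words n)"
  by (rule countable_subset[OF _ countable_lists[OF countable_finite[OF finite_letters[of n]]]])
    (auto simp: words_def)

section \<open>A generating family for the Borel sets\<close>

text \<open>Length at least 2 leaves a nonempty word after one letter is cancelled, so preimages
  under a letter are cylinders of known measure. The empty set makes the family stable under
  intersection.\<close>

definition cylinders :: "nat \<Rightarrow> point set set" where
  "cylinders n = insert {} (cylinder n ` {w \<in> words n. 2 \<le> length w})"

lemma space_borel_of: "space (borel_of X) = topspace X"
  by (simp add: borel_of_def space_measure_of_conv)

lemma sets_borel_of: "sets (borel_of X) = sigma_sets (topspace X) {U. openin X U}"
  unfolding borel_of_def by (rule sets_measure_of) (auto dest: openin_subset)

lemma sets_borel_of_ray_space: "sets (borel_of (ray_space n)) = sigma_sets (rays n) (cylinders n)"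
proof -
  have "sigma_sets (rays n) {U. openin (ray_space n) U} = sigma_sets (rays n) (cylinders n)"
  proof (rule sigma_sets_eqI)
    fix U assume "U \<in> {U. openin (ray_space n) U}"
    then have U: "openin (ray_space n) U" "U \<subseteq> rays n"
      using openin_subset[of "ray_space n" U] by auto
    let ?W = "{w \<in> words n. 2 \<le> length w \<and> cylinder n w \<subseteq> U}"
    have "U \<subseteq> \<Union>(cylinder n ` ?W)"
    proof
      fix \<xi> assume \<xi>: "\<xi> \<in> U"
      then obtain m where "\<forall>k\<ge>m. cylinder n (map \<xi> [0..<k]) \<subseteq> U"
        using ray_space_neighbourhood[OF U(1)] by blast
      then have "cylinder n (map \<xi> [0..<m + 2]) \<subseteq> U"
        by (meson le_add1)
      moreover have "\<xi> \<in> rays n" using \<xi> U(2) by blast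
      ultimately show "\<xi> \<in> \<Union>(cylinder n ` ?W)"
        by (intro UN_I[of "map \<xi> [0..<m + 2]"] CollectI conjI cylinder_prefix prefix_words) simp_all
    qed
    then have U_eq: "U = \<Union>(cylinder n ` ?W)" by blast
    have "countable (cylinder n ` ?W)"
      by (rule countable_image, rule countable_subset[OF _ countable_words[of n]]) blast
    then have "\<Union>(cylinder n ` ?W) \<in> sigma_sets (rays n) (cylinders n)"
      by (rule sigma_sets_UNION) (auto simp: cylinders_def)
    with U_eq show "U \<in> sigma_sets (rays n) (cylinders n)" by simp
  next
    fix A assume "A \<in> cylinders n"
    then have "openin (ray_space n) A" by (auto simp: cylinders_def openin_cylinder)
    then show "A \<in> sigma_sets (rays n) {U. openin (ray_space n) U}" by (intro sigma_sets.Basic) simp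
  qed
  then show ?thesis by (simp add: sets_borel_of)
qed

lemma cylinder_Int:
  assumes "length v \<le> length w"
  shows "cylinder n v \<inter> cylinder n w = (if \<forall>i<length v. v ! i = w ! i then cylinder n w else {})"
  using assms by (auto simp: cylinder_def)

lemma Int_stable_cylinders: "Int_stable (cylinders n)"
proof -
  have *: "cylinder n v \<inter> cylinder n w \<in> cylinders n"
    if "v \<in> {w \<in> words n. 2 \<le> length w}" "w \<in> {w \<in> words n. 2 \<le> length w}" "length v \<le> length w" for v w
    unfolding cylinder_Int[OF that(3)] using that(2) by (simp add: cylinders_def)
  have "cylinder n v \<inter> cylinder n w \<in> cylinders n"
    if "v \<in> {w \<in> words n. 2 \<le> length w}" "w \<in> {w \<in> words n. 2 \<le> length w}" for v w
    using *[of v w] *[of w v] that by (cases "length v \<le> length w") (auto simp: Int_commute)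
  then show ?thesis
    by (auto simp: Int_stable_def cylinders_def)
qed

lemma measure_eqI_cylinders:
  assumes "finite_measure M"
    and sets: "sets M = sets (borel_of (ray_space n))" "sets N = sets (borel_of (ray_space n))"
    and eq: "\<And>w. w \<in> words n \<Longrightarrow> 2 \<le> length w \<Longrightarrow> emeasure M (cylinder n w) = emeasure N (cylinder n w)"
  shows "M = N"
proof (rule measure_eqI_generator_eq_countable)
  interpret finite_measure M by fact
  show "Int_stable (cylinders n)" by (rule Int_stable_cylinders)
  show "cylinders n \<subseteq> Pow (rays n)"
    using cylinder_subset_rays by (auto simp: cylinders_def)
  show "emeasure M A = emeasure N A" if "A \<in> cylinders n" for A
    using that eq by (auto simp: cylinders_def)
  show "sets M = sigma_sets (rays n) (cylinders n)" "sets N = sigma_sets (rays n) (cylinders n)"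
    by (simp_all add: sets sets_borel_of_ray_space)
  show "cylinders n \<subseteq> cylinders n" by simp
  have "\<exists>A\<in>cylinders n. \<xi> \<in> A" if "\<xi> \<in> rays n" for \<xi>
    using that by (intro bexI[of _ "cylinder n (map \<xi> [0..<2])"] cylinder_prefix)
      (auto simp: cylinders_def intro!: imageI prefix_words[of _ _ 2])
  then show "\<Union>(cylinders n) = rays n"
    using cylinder_subset_rays by (auto simp: cylinders_def)
  show "countable (cylinders n)"
    unfolding cylinders_def
    by (intro countable_insert countable_image countable_subset[OF _ countable_words[of n]]) blast
  show "emeasure M A \<noteq> \<infinity>" for A by simp
qed

section \<open>Construction of the uniform measure\<close>

text \<open>A uniform element of A as a function of a uniform number. The letters allowed next
  depend on the current one; coding the choice by numbers makes all steps live on one product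
  space.\<close>

lemma ex_uniform_choice:
  assumes "finite A" "A \<noteq> {}"
  shows "\<exists>f :: nat \<Rightarrow> 'a. \<forall>t. f t \<in> A \<and>
    (\<forall>y\<in>A. measure_pmf.prob (pmf_of_set {..<card A}) {t. f t = y} = 1 / real (card A))"
proof -
  obtain b where b: "bij_betw b {..<card A} A"
    using ex_bij_betw_nat_finite[OF assms(1)] by (auto simp: atLeast0LessThan)
  obtain c where c: "c \<in> A" using assms(2) by blast
  have card: "card A > 0" using assms by (simp add: card_gt_0_iff)
  define f where "f t = (if t < card A then b t else c)" for t
  have "measure_pmf.prob (pmf_of_set {..<card A}) {t. f t = y} = 1 / real (card A)" if y: "y \<in> A" for y
  proof -
    obtain s where s: "s < card A" "b s = y"
      using b y by (metis bij_betw_imp_surj_on imageE lessThan_iff)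
    then have "{..<card A} \<inter> {t. f t = y} = {s}"
      using b by (auto simp: f_def bij_betw_def inj_on_def)
    then show ?thesis
      using card by (subst measure_pmf_of_set) auto
  qed
  moreover have "f t \<in> A" for t
    using b c by (auto simp: f_def bij_betw_def)
  ultimately show ?thesis by blast
qed

text \<open>The law of the non-backtracking walk: a uniform first letter, then each letter uniform
  among the 2n - 1 that do not cancel its predecessor. It is the image of a product measure under a
  recursive decoding.\<close>

lemma ex_ray_measure:
  assumes "n \<ge> 1"
  shows "\<exists>\<nu>. prob_space \<nu> \<and> sets \<nu> = sets (borel_of (ray_space n)) \<and>
    (\<forall>w\<in>words n. w \<noteq> [] \<longrightarrow>
      measure \<nu> (cylinder n w) = 1 / (2 * real n * (2 * real n - 1) ^ (length w - 1)))"
proof -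
  have "letters n \<noteq> {}" using card_letters[of n] assms by auto
  then obtain e :: "nat \<Rightarrow> real" where e: "\<And>t. e t \<in> letters n"
    "\<And>y. y \<in> letters n \<Longrightarrow> measure_pmf.prob (pmf_of_set {..<2 * n}) {t. e t = y} = 1 / real (2 * n)"
    using ex_uniform_choice[of "letters n"] by (auto simp: card_letters)
  have "\<exists>f :: nat \<Rightarrow> real. \<forall>t. f t \<in> letters n - {- x} \<and> (\<forall>y\<in>letters n - {- x}.
      measure_pmf.prob (pmf_of_set {..<2 * n - 1}) {t. f t = y} = 1 / real (2 * n - 1))"
    if x: "x \<in> letters n" for x
  proof -
    have "card (letters n - {- x}) = 2 * n - 1" "letters n - {- x} \<noteq> {}"
      using x letters_neq_uminus[OF x] by (auto simp: card_letters)
    then show ?thesis using ex_uniform_choice[of "letters n - {- x}"] by simp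
  qed
  then obtain h :: "real \<Rightarrow> nat \<Rightarrow> real" where h:
    "\<And>x t. x \<in> letters n \<Longrightarrow> h x t \<in> letters n - {- x}"
    "\<And>x y. x \<in> letters n \<Longrightarrow> y \<in> letters n - {- x} \<Longrightarrow>
      measure_pmf.prob (pmf_of_set {..<2 * n - 1}) {t. h x t = y} = 1 / real (2 * n - 1)"
    by metis
  define p where "p i = measure_pmf (pmf_of_set (if i = 0 then {..<2 * n} else {..<2 * n - 1}))" for i :: nat
  define P where "P = PiM UNIV p"
  interpret P: product_prob_space p UNIV
    by (rule product_prob_spaceI) (simp add: p_def measure_pmf.prob_space_axioms)
  have sets_p: "A \<in> sets (p i)" for A i by (simp add: p_def)
  define ray where "ray \<omega> = rec_nat (e (\<omega> 0)) (\<lambda>i x. h x (\<omega> (Suc i)))" for \<omega> :: "nat \<Rightarrow> nat"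
  have ray_simps: "ray \<omega> 0 = e (\<omega> 0)" "ray \<omega> (Suc i) = h (ray \<omega> i) (\<omega> (Suc i))" for \<omega> i
    by (simp_all add: ray_def)
  have ray_letters: "ray \<omega> i \<in> letters n" for \<omega> i
    by (induction i) (use e h in \<open>auto simp: ray_simps\<close>)
  then have ray_rays: "ray \<omega> \<in> rays n" for \<omega>
    using h(1) by (auto simp: rays_def ray_simps(2))
  \<comment> \<open>The set refers to the preceding letter of w, not of the ray. The two agree as
    long as the ray has followed w, so following w is a product event in the independent
    numbers.\<close>
  define A where "A w i = (case i of 0 \<Rightarrow> {t. e t = w ! 0} | Suc j \<Rightarrow> {t. h (w ! j) t = w ! Suc j})"
    for w :: "real list" and i
  have "(\<forall>i<m. ray \<omega> i = w ! i) \<longleftrightarrow> (\<forall>i<m. \<omega> i \<in> A w i)" for \<omega> w m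
  proof (induction m)
    case (Suc m)
    then show ?case by (cases m) (auto simp: less_Suc_eq A_def ray_simps)
  qed simp
  then have ray_cylinder: "ray \<omega> \<in> cylinder n w \<longleftrightarrow> (\<forall>i\<in>{..<length w}. \<omega> i \<in> A w i)" for \<omega> w
    using ray_rays by (simp add: cylinder_def Ball_def)
  have component: "(\<lambda>\<omega>. \<omega> i) \<in> measurable P (count_space UNIV)" for i
    using measurable_component_singleton[of i UNIV p] by (simp add: P_def p_def)
  have vimage: "ray -` cylinder n w \<inter> space P = {\<omega> \<in> space P. \<forall>i\<in>{..<length w}. \<omega> i \<in> A w i}" for w
    using ray_cylinder by auto
  have ray_measurable: "ray \<in> measurable P (borel_of (ray_space n))"
  proof (rule measurable_sigma_sets[OF sets_borel_of_ray_space])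
    show "cylinders n \<subseteq> Pow (rays n)"
      using cylinder_subset_rays by (auto simp: cylinders_def)
    show "ray \<in> space P \<rightarrow> rays n" using ray_rays by simp
    fix B assume "B \<in> cylinders n"
    moreover have "{\<omega> \<in> space P. \<forall>i\<in>{..<length w}. \<omega> i \<in> A w i} \<in> sets P" for w
      by (rule sets.sets_Collect_finite_All) (auto intro: measurable_sets_Collect[OF component])
    ultimately show "ray -` B \<inter> space P \<in> sets P"
      by (auto simp: cylinders_def vimage)
  qed
  define \<nu> where "\<nu> = distr P (borel_of (ray_space n)) ray"
  have "measure \<nu> (cylinder n w) = 1 / (2 * real n * (2 * real n - 1) ^ (length w - 1))"
    if w: "w \<in> words n" "w \<noteq> []" for w
  proof -
    have "cylinder n w \<in> sets (borel_of (ray_space n))"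
      using openin_cylinder by (auto simp: sets_borel_of)
    then have "measure \<nu> (cylinder n w) = measure P {\<omega> \<in> space P. \<forall>i\<in>{..<length w}. \<omega> i \<in> A w i}"
      unfolding \<nu>_def by (simp add: measure_distr[OF ray_measurable] vimage)
    also have "\<dots> = (\<Prod>i\<in>{..<length w}. measure (p i) (A w i))"
      unfolding P_def
      by (rule measure_eq_emeasure_eq_ennreal, simp add: prod_nonneg, subst P.emeasure_PiM_Collect)
        (auto simp: p_def measure_pmf.emeasure_eq_measure prod_ennreal)
    also have "\<dots> = measure (p 0) (A w 0) * (\<Prod>i<length w - 1. measure (p (Suc i)) (A w (Suc i)))"
      using w(2) by (cases w) (simp_all add: prod.lessThan_Suc_shift del: prod.lessThan_Suc)
    also have "measure (p 0) (A w 0) = 1 / (2 * real n)"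
      using w e(2)[of "w ! 0"] by (cases w) (auto simp: p_def A_def Cons_words)
    also have "(\<Prod>i<length w - 1. measure (p (Suc i)) (A w (Suc i))) = (\<Prod>i<length w - 1. 1 / (2 * real n - 1))"
    proof (rule prod.cong[OF refl])
      fix i assume "i \<in> {..<length w - 1}"
      then have i: "Suc i < length w" by auto
      then have "w ! Suc i \<noteq> - (w ! i)" "w ! Suc i \<in> letters n" "w ! i \<in> letters n"
        using w by (auto simp: words_def successively_conv_nth)
      then show "measure (p (Suc i)) (A w (Suc i)) = 1 / (2 * real n - 1)"
        using h(2)[of "w ! i" "w ! Suc i"] assms by (simp add: p_def A_def of_nat_diff)
    qed
    finally show ?thesis by (simp add: power_one_over)
  qed
  moreover have "prob_space \<nu>"
    unfolding \<nu>_def P_def using ray_measurable by (intro P.prob_space_distr) (simp add: P_def)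
  ultimately show ?thesis by (intro exI[of _ \<nu>]) (simp add: \<nu>_def)
qed

definition ray_measure :: "nat \<Rightarrow> point measure" where
  "ray_measure n = (SOME \<nu>. prob_space \<nu> \<and> sets \<nu> = sets (borel_of (ray_space n)) \<and>
    (\<forall>w\<in>words n. w \<noteq> [] \<longrightarrow>
      measure \<nu> (cylinder n w) = 1 / (2 * real n * (2 * real n - 1) ^ (length w - 1))))"

lemma ray_measure:
  assumes "n \<ge> 1"
  shows prob_space_ray_measure: "prob_space (ray_measure n)"
    and sets_ray_measure: "sets (ray_measure n) = sets (borel_of (ray_space n))"
    and measure_cylinder: "w \<in> words n \<Longrightarrow> w \<noteq> [] \<Longrightarrow>
      measure (ray_measure n) (cylinder n w) = 1 / (2 * real n * (2 * real n - 1) ^ (length w - 1))"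
  using someI_ex[OF ex_ray_measure[OF assms], folded ray_measure_def] by blast+

lemma space_ray_measure: "n \<ge> 1 \<Longrightarrow> space (ray_measure n) = rays n"
  using sets_eq_imp_space_eq[OF sets_ray_measure] by (simp add: space_borel_of)

section \<open>Measurability, and how letters move the uniform measure\<close>

lemma measurable_borel_of:
  assumes "continuous_map X Y f"
  shows "f \<in> measurable (borel_of X) (borel_of Y)"
proof (rule measurable_sigma_sets[OF sets_borel_of])
  show "f \<in> space (borel_of X) \<rightarrow> topspace Y"
    using continuous_map_image_subset_topspace[OF assms] by (auto simp: space_borel_of)
  fix U assume "U \<in> {U. openin Y U}"
  then have "openin X {x \<in> topspace X. f x \<in> U}"
    using assms by (simp add: continuous_map_def)
  moreover have "f -` U \<inter> space (borel_of X) = {x \<in> topspace X. f x \<in> U}"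
    by (auto simp: space_borel_of)
  ultimately show "f -` U \<inter> space (borel_of X) \<in> sets (borel_of X)"
    by (simp add: sets_borel_of sigma_sets.Basic)
qed (auto dest: openin_subset)

lemma borel_measurable_borel_of:
  fixes f :: "'a \<Rightarrow> real"
  assumes "continuous_map X euclideanreal f"
  shows "f \<in> borel_measurable (borel_of X)"
proof -
  have "sets (borel_of euclideanreal) = sets borel"
    by (simp add: sets_borel_of borel_def)
  then show ?thesis
    using measurable_borel_of[OF assms] by (simp cong: measurable_cong_sets)
qed

lemma measurable_ray_measure:
  assumes "n \<ge> 1" "continuous_map (ray_space n) (ray_space n) f"
  shows "f \<in> measurable (ray_measure n) (ray_measure n)"
  using measurable_borel_of[OF assms(2)] sets_ray_measure[OF assms(1)] by (simp cong: measurable_cong_sets)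

lemma borel_measurable_ray_measure:
  fixes f :: "point \<Rightarrow> real"
  assumes "n \<ge> 1" "continuous_map (ray_space n) euclideanreal f"
  shows "f \<in> borel_measurable (ray_measure n)"
  using borel_measurable_borel_of[OF assms(2)] sets_ray_measure[OF assms(1)] by (simp cong: measurable_cong_sets)

lemma cylinder_in_sets: "n \<ge> 1 \<Longrightarrow> cylinder n w \<in> sets (ray_measure n)"
  by (simp add: sets_ray_measure sets_borel_of openin_cylinder sigma_sets.Basic)

lemma coordinate_measurable: "n \<ge> 1 \<Longrightarrow> (\<lambda>\<xi>. \<xi> i) \<in> borel_measurable (ray_measure n)"
  by (rule borel_measurable_ray_measure)
    (auto simp: ray_space_def intro: continuous_on_subset[OF continuous_on_product_coordinates])

text \<open>The two cases of the definition live on complementary sets that are both open in the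
  space of rays.\<close>

lemma continuous_map_ray_push:
  assumes "x \<in> letters n"
  shows "continuous_map (ray_space n) (ray_space n) (ray_push x)"
proof -
  define S where "S = {\<xi> \<in> rays n. \<xi> 0 \<in> {- x}}"
  define S' where "S' = {\<xi> \<in> rays n. \<xi> 0 \<in> - {- x}}"
  have S: "rays n = S \<union> S'" by (auto simp: S_def S'_def)
  have "continuous_on (S \<union> S') (\<lambda>\<xi>. if \<xi> 0 = - x then (\<lambda>i. \<xi> (Suc i)) else case_nat x \<xi>)"
  proof (rule continuous_on_cases_local_open)
    show "openin (top_of_set (S \<union> S')) S" "openin (top_of_set (S \<union> S')) S'"
      using openin_ray_space_coordinate[of n 0 "{- x}"] openin_ray_space_coordinate[of n 0 "- {- x}"]
      by (simp_all only: S[symmetric] S_def[symmetric] S'_def[symmetric] ray_space_def)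
    show "continuous_on S (\<lambda>\<xi> i. \<xi> (Suc i))"
      by (intro continuous_on_coordinatewise_then_product
          continuous_on_subset[OF continuous_on_product_coordinates]) simp
    show "continuous_on S' (\<lambda>\<xi>. case_nat x \<xi>)"
    proof (rule continuous_on_coordinatewise_then_product)
      show "continuous_on S' (\<lambda>\<xi>. case_nat x \<xi> i)" for i
        by (cases i) (auto intro: continuous_on_subset[OF continuous_on_product_coordinates])
    qed
  qed (auto simp: S_def S'_def)
  then have "continuous_on (rays n) (ray_push x)"
    by (simp add: S ray_push_def[abs_def])
  moreover have "ray_push x \<in> rays n \<rightarrow> rays n"
    using ray_push_rays[OF assms] by simp
  ultimately show ?thesis
    by (simp add: ray_space_def)
qed

lemma ray_push_cylinder:
  assumes "x \<in> letters n" "w \<noteq> []" "\<xi> \<in> cylinder n w"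
  shows "ray_push x \<xi> \<in> cylinder n (push x w)"
proof -
  have "\<xi> 0 = hd w" "\<xi> \<in> rays n" "\<And>i. i < length w \<Longrightarrow> \<xi> i = w ! i"
    using assms(2,3) by (auto simp: cylinder_def hd_conv_nth)
  then show ?thesis
    using ray_push_rays[OF assms(1), of \<xi>] assms(2)
    by (auto simp: cylinder_def ray_push_def push_def nth_tl nth_Cons split: nat.splits)
qed

text \<open>Since w has length at least 2, \<open>push (- x) w\<close> is nonempty, so
  \<open>ray_push_cylinder\<close> applies to x and to its inverse and yields both
  inclusions.\<close>

lemma ray_push_vimage_cylinder:
  assumes x: "x \<in> letters n" and w: "w \<in> words n" "2 \<le> length w"
  shows "{\<xi> \<in> rays n. ray_push x \<xi> \<in> cylinder n w} = cylinder n (push (- x) w)"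
proof -
  have "w \<noteq> []" using w(2) by auto
  have "push (- x) w \<noteq> []" using w(2) by (cases w) (auto simp: push_def)
  have "push x (push (- x) w) = w" using push_uminus_push[OF w(1), of "- x"] by simp
  with \<open>push (- x) w \<noteq> []\<close> have "ray_push x \<xi> \<in> cylinder n w" if "\<xi> \<in> cylinder n (push (- x) w)" for \<xi>
    using ray_push_cylinder[OF x _ that] by simp
  moreover have "\<xi> \<in> cylinder n (push (- x) w)" if "\<xi> \<in> rays n" "ray_push x \<xi> \<in> cylinder n w" for \<xi>
    using ray_push_cylinder[of "- x", OF _ \<open>w \<noteq> []\<close> that(2)] x ray_push_uminus_push[OF that(1)] by simp
  ultimately show ?thesis using cylinder_subset_rays by blast
qed

text \<open>The Radon-Nikodym derivative of the translate by x: the preimage of a long cylinder is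
  one letter shorter if its rays begin with x and one letter longer otherwise. Killed letters
  preserve the measure.\<close>

definition letter_density :: "nat \<Rightarrow> real \<Rightarrow> point \<Rightarrow> real" where
  "letter_density n x \<xi> = (if \<bar>x\<bar> \<le> real n then
     if \<xi> 0 = x then 2 * real n - 1 else 1 / (2 * real n - 1) else 1)"

lemma letter_density_pos: "n \<ge> 1 \<Longrightarrow> letter_density n x \<xi> > 0"
  by (simp add: letter_density_def)

lemma letter_density_measurable:
  assumes "n \<ge> 1"
  shows "letter_density n x \<in> borel_measurable (ray_measure n)"
proof -
  note coordinate_measurable[OF assms, measurable]
  show ?thesis unfolding letter_density_def[abs_def] by measurable
qed

lemma distr_ray_push:
  assumes n: "n \<ge> 1" and x: "x \<in> letters n"
  shows "distr (ray_measure n) (ray_measure n) (ray_push x) =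
    density (ray_measure n) (\<lambda>\<xi>. ennreal (letter_density n x \<xi>))"
proof (rule measure_eqI_cylinders)
  interpret prob_space "ray_measure n" by (rule prob_space_ray_measure[OF n])
  note meas = measurable_ray_measure[OF n continuous_map_ray_push[OF x]]
  show "finite_measure (distr (ray_measure n) (ray_measure n) (ray_push x))"
    using prob_space_distr[OF meas] by (simp add: prob_space_def)
  show "sets (distr (ray_measure n) (ray_measure n) (ray_push x)) = sets (borel_of (ray_space n))"
    "sets (density (ray_measure n) (\<lambda>\<xi>. ennreal (letter_density n x \<xi>))) = sets (borel_of (ray_space n))"
    by (simp_all add: sets_ray_measure[OF n])
  fix w assume w: "w \<in> words n" "2 \<le> length w"
  then obtain y z v where w_eq: "w = y # z # v" by (auto simp: Suc_le_length_iff numeral_2_eq_2)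
  then have "w \<noteq> []" by simp
  have q: "2 * real n - 1 > 0" "x \<le> real n" "- x \<le> real n" using n x by (auto simp: letters_def)
  have pw: "push (- x) w \<in> words n" "push (- x) w \<noteq> []"
    using x w push_words[of "- x" n w] by (auto simp: w_eq push_def)
  have "emeasure (distr (ray_measure n) (ray_measure n) (ray_push x)) (cylinder n w) =
      emeasure (ray_measure n) {\<xi> \<in> rays n. ray_push x \<xi> \<in> cylinder n w}"
    by (subst emeasure_distr[OF meas cylinder_in_sets[OF n]])
      (auto intro!: arg_cong[where f = "emeasure _"] simp: space_ray_measure[OF n])
  also have "\<dots> = ennreal (1 / (2 * real n * (2 * real n - 1) ^ (length (push (- x) w) - 1)))"
    unfolding ray_push_vimage_cylinder[OF x w] emeasure_eq_measure measure_cylinder[OF n pw] ..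
  \<comment> \<open>The density sees only the first letter, so the constant sequence
    \<open>\<lambda>_. y\<close> stands in for every ray of the cylinder.\<close>
  also have "1 / (2 * real n * (2 * real n - 1) ^ (length (push (- x) w) - 1)) =
      letter_density n x (\<lambda>_. y) * (1 / (2 * real n * (2 * real n - 1) ^ (length w - 1)))"
    using q by (simp add: w_eq push_def letter_density_def abs_le_iff)
  also have "ennreal \<dots> = ennreal (letter_density n x (\<lambda>_. y)) * emeasure (ray_measure n) (cylinder n w)"
    unfolding emeasure_eq_measure measure_cylinder[OF n w(1) \<open>w \<noteq> []\<close>]
    by (rule ennreal_mult') (simp add: letter_density_pos[OF n] less_imp_le)
  also have "\<dots> = (\<integral>\<^sup>+\<xi>. ennreal (letter_density n x (\<lambda>_. y)) * indicator (cylinder n w) \<xi> \<partial>ray_measure n)"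
    by (rule nn_integral_cmult_indicator[symmetric]) (rule cylinder_in_sets[OF n])
  also have "\<dots> = (\<integral>\<^sup>+\<xi>. ennreal (letter_density n x \<xi>) * indicator (cylinder n w) \<xi> \<partial>ray_measure n)"
    by (intro nn_integral_cong) (auto simp: indicator_def cylinder_def w_eq letter_density_def)
  also have "\<dots> = emeasure (density (ray_measure n) (\<lambda>\<xi>. ennreal (letter_density n x \<xi>))) (cylinder n w)"
    using letter_density_measurable[OF n] cylinder_in_sets[OF n] by (subst emeasure_density) auto
  finally show "emeasure (distr (ray_measure n) (ray_measure n) (ray_push x)) (cylinder n w) =
      emeasure (density (ray_measure n) (\<lambda>\<xi>. ennreal (letter_density n x \<xi>))) (cylinder n w)" .
qed

lemma measure_first_letter:
  assumes "n \<ge> 1" "x \<in> letters n"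
  shows "measure (ray_measure n) {\<xi> \<in> rays n. \<xi> 0 = x} = 1 / (2 * real n)"
proof -
  have "{\<xi> \<in> rays n. \<xi> 0 = x} = cylinder n [x]" by (auto simp: cylinder_def)
  then show ?thesis using measure_cylinder[OF assms(1), of "[x]"] assms(2) by (simp add: Cons_words)
qed

text \<open>With L = ln (2n - 1), the integrand is -L on the rays beginning with x, which have
  measure 1 / (2n), and L elsewhere.\<close>

lemma integral_ln_letter_density:
  assumes n: "n \<ge> 1" and x: "x \<in> letters n"
  shows "(\<integral>\<xi>. - ln (letter_density n x \<xi>) \<partial>ray_measure n) =
    (real n - 1) / real n * ln (2 * real n - 1)"
proof -
  interpret prob_space "ray_measure n" by (rule prob_space_ray_measure[OF n])
  let ?L = "ln (2 * real n - 1)"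
  let ?A = "{\<xi> \<in> rays n. \<xi> 0 = x}"
  have A: "?A \<in> sets (ray_measure n)"
    using openin_ray_space_coordinate[of n 0 "{x}"]
    by (simp add: sets_ray_measure[OF n] sets_borel_of sigma_sets.Basic)
  have "\<bar>x\<bar> \<le> real n" using x by (auto simp: letters_def)
  then have "(\<integral>\<xi>. - ln (letter_density n x \<xi>) \<partial>ray_measure n) = (\<integral>\<xi>. ?L - 2 * ?L * indicator ?A \<xi> \<partial>ray_measure n)"
    using n by (intro Bochner_Integration.integral_cong)
      (auto simp: letter_density_def space_ray_measure ln_div indicator_def)
  also have "\<dots> = ?L - 2 * ?L * measure (ray_measure n) ?A"
    using A by (simp add: prob_space integrable_real_indicator emeasure_eq_measure)
  also have "\<dots> = (real n - 1) / real n * ?L"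
    using n by (simp add: measure_first_letter[OF n x] field_simps)
  finally show ?thesis .
qed

section \<open>The boundary action\<close>

text \<open>A ray that begins with the inverse word is eaten letter by letter. Such rays are the
  exceptional set of the contraction argument.\<close>

lemma foldr_ray_push_shift:
  "w \<in> words n \<Longrightarrow> \<xi> \<in> cylinder n (map uminus (rev w)) \<Longrightarrow> foldr ray_push w \<xi> = (\<lambda>i. \<xi> (i + length w))"
proof (induction w)
  case (Cons x w)
  have "\<xi> \<in> cylinder n (map uminus (rev w))" "\<xi> (length w) = - x"
    using Cons.prems(2) by (auto simp: cylinder_def nth_append split: if_splits)
  moreover have "w \<in> words n" using Cons.prems(1) by (simp add: Cons_words)
  ultimately show ?case
    by (simp add: Cons.IH ray_push_def[of x])
qed simp

text \<open>Rays outside the cylinder of the inverse word are not cancelled completely by the word.\<close>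

lemma foldr_ray_push_hd:
  "w \<in> words n \<Longrightarrow> w \<noteq> [] \<Longrightarrow> \<xi> \<in> rays n \<Longrightarrow> \<xi> \<notin> cylinder n (map uminus (rev w)) \<Longrightarrow>
    foldr ray_push w \<xi> 0 = hd w"
proof (induction w)
  case (Cons x w)
  have w: "w \<in> words n" "w \<noteq> [] \<Longrightarrow> hd w \<noteq> - x" using Cons.prems(1) by (auto simp: Cons_words)
  have "foldr ray_push w \<xi> 0 \<noteq> - x"
  proof (cases "\<xi> \<in> cylinder n (map uminus (rev w))")
    case True
    then have "\<xi> (length w) \<noteq> - x"
      using Cons.prems(4) by (auto simp: cylinder_def nth_append less_Suc_eq split: if_splits)
    then show ?thesis by (simp add: foldr_ray_push_shift[OF w(1) True])
  next
    case False
    then have "w \<noteq> []" using Cons.prems(3) by (auto simp: cylinder_def)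
    then show ?thesis using Cons.IH[OF w(1) _ Cons.prems(3) False] w(2) by simp
  qed
  then show ?case by (simp add: ray_push_def[of x])
qed simp

text \<open>Outside one cylinder v is not cancelled completely, and its surviving head shields u. A
  long v makes that cylinder small, which is the contraction behind proximality.\<close>

lemma foldr_ray_push_prefix:
  assumes "u @ v \<in> words n" "v \<noteq> []" "\<xi> \<in> rays n" "\<xi> \<notin> cylinder n (map uminus (rev v))"
  shows "\<forall>i<length u. foldr ray_push (u @ v) \<xi> i = u ! i"
proof -
  have "foldr ray_push (u @ v) \<xi> 0 = hd (u @ v) \<and> (\<forall>i<length u. foldr ray_push (u @ v) \<xi> i = u ! i)"
    using assms(1)
  proof (induction u)
    case Nil
    then show ?case using foldr_ray_push_hd[of v n \<xi>] assms by simp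
  next
    case (Cons x u)
    then have "u @ v \<in> words n" "hd (u @ v) \<noteq> - x"
      using assms(2) Cons_words[of x "u @ v" n] by auto
    with Cons.IH show ?case
      by (auto simp: ray_push_def nth_Cons split: nat.splits)
  qed
  then show ?thesis by blast
qed

text \<open>Once the length stays above i, position i is never rewritten, because each step changes
  only the end of the word.\<close>

lemma words_limit_ray:
  assumes W: "\<And>m. W m \<in> words n"
    and step: "\<And>m. W (Suc m) = W m \<or> W (Suc m) = butlast (W m) \<or> (\<exists>x. W (Suc m) = W m @ [x])"
    and len: "\<And>j. eventually (\<lambda>m. j < length (W m)) sequentially"
  shows "\<exists>\<xi>\<in>rays n. \<forall>j. eventually (\<lambda>m. j \<le> length (W m) \<and> (\<forall>i<j. W m ! i = \<xi> i)) sequentially"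
proof -
  obtain N where N: "\<And>j m. N j \<le> m \<Longrightarrow> j < length (W m)"
    using len unfolding eventually_sequentially by metis
  define \<xi> where "\<xi> i = W (N i) ! i" for i
  have \<xi>: "W m ! i = \<xi> i" if "N i \<le> m" for i m
    using that
  proof (induction m rule: dec_induct)
    case (step m)
    have "i < length (W m)" "i < length (W (Suc m))" using N[of i] step.hyps by auto
    then have "W (Suc m) ! i = W m ! i"
      using assms(2)[of m] by (auto simp: nth_butlast nth_append)
    then show ?case using step.IH by simp
  qed (simp add: \<xi>_def)
  have "\<xi> i \<in> letters n \<and> \<xi> (Suc i) \<noteq> - \<xi> i" for i
  proof -
    define m where "m = max (N i) (N (Suc i))"
    have "Suc i < length (W m)" "W m ! i = \<xi> i" "W m ! Suc i = \<xi> (Suc i)"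
      using N[of "Suc i" m] \<xi>[of i m] \<xi>[of "Suc i" m] by (auto simp: m_def)
    then show ?thesis
      using W[of m] nth_mem[of i "W m"] by (auto simp: words_def successively_conv_nth)
  qed
  then have "\<xi> \<in> rays n" by (simp add: rays_def)
  moreover have "eventually (\<lambda>m. j \<le> length (W m) \<and> (\<forall>i<j. W m ! i = \<xi> i)) sequentially" for j
  proof -
    have "eventually (\<lambda>m. \<forall>i\<in>{..<j}. W m ! i = \<xi> i) sequentially"
      by (rule eventually_ball_finite) (auto simp: eventually_sequentially intro: \<xi>)
    with len[of j] show ?thesis by eventually_elim auto
  qed
  ultimately show ?thesis by blast
qed

section \<open>The action on rays, stationarity and Furstenberg entropy\<close>

context free_walk
begin

lemma rays_action: "n \<le> d \<Longrightarrow> free_basis_action \<Gamma> a d (kill n ray_push) (rays n)"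
  by unfold_locales (auto simp: kill_ray_push_rays kill_ray_push_uminus)

definition ray_act :: "nat \<Rightarrow> 'g \<Rightarrow> point \<Rightarrow> point" where
  "ray_act n = letter_action (kill n ray_push) (rays n)"

lemma ray_act_gen:
  "n \<le> d \<Longrightarrow> x \<in> letters d \<Longrightarrow> \<xi> \<in> rays n \<Longrightarrow> ray_act n (gen x) \<xi> = kill n ray_push x \<xi>"
  unfolding ray_act_def by (rule free_basis_action.letter_action_gen[OF rays_action])

lemma ray_act_eq_foldr:
  assumes "n \<le> d" "g \<in> carrier \<Gamma>" "\<xi> \<in> rays n"
  shows "ray_act n g \<xi> = foldr ray_push (red n g) \<xi>"
  using assms rep(1)[of g]
    foldr_kill[where S = "rays n" and T = ray_push and n = n and d = d and w = "rep g" and s = \<xi>,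
      OF ray_push_rays ray_push_uminus_push]
  by (simp add: ray_act_def letter_action_def red_eq)

lemma continuous_map_kill_ray_push:
  assumes "n \<le> d" "x \<in> letters d"
  shows "continuous_map (ray_space n) (ray_space n) (kill n ray_push x)"
proof (cases "\<bar>x\<bar> \<le> real n")
  case True
  then have "x \<in> letters n" using assms letters_restrict by auto
  then show ?thesis
    using continuous_map_ray_push True by (simp add: kill_def[abs_def])
next
  case False
  then show ?thesis by (simp add: kill_def[abs_def])
qed

lemma continuous_map_ray_act:
  assumes "n \<le> d" "g \<in> carrier \<Gamma>"
  shows "continuous_map (ray_space n) (ray_space n) (ray_act n g)"
proof -
  have "continuous_map (ray_space n) (ray_space n) (foldr (kill n ray_push) w)"
    if "set w \<subseteq> letters d" for w
    using that
  proof (induction w)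
    case (Cons x w)
    then have "continuous_map (ray_space n) (ray_space n) (kill n ray_push x \<circ> foldr (kill n ray_push) w)"
      by (intro continuous_map_compose[OF _ continuous_map_kill_ray_push[OF assms(1)]]) auto
    then show ?case by (simp only: foldr.simps)
  qed (simp add: id_def)
  then have "continuous_map (ray_space n) (ray_space n) (foldr (kill n ray_push) (rep g))"
    using rep assms by blast
  then show ?thesis
    by (rule continuous_map_eq) (simp add: ray_act_def letter_action_def)
qed

lemma continuous_action_ray_act:
  assumes "n \<le> d"
  shows "continuous_action \<Gamma> (ray_space n) (ray_act n)"
  unfolding continuous_action_def
  using free_basis_action.group_action_letter_action[OF rays_action[OF assms]]
    continuous_map_ray_act[OF assms] by (simp add: ray_act_def)

lemma distr_ray_act_gen:
  assumes "1 \<le> n" "n \<le> d" "x \<in> letters d"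
  shows "distr (ray_measure n) (ray_measure n) (ray_act n (gen x)) =
    density (ray_measure n) (\<lambda>\<xi>. ennreal (letter_density n x \<xi>))"
proof -
  have "distr (ray_measure n) (ray_measure n) (ray_act n (gen x)) =
      distr (ray_measure n) (ray_measure n) (kill n ray_push x)"
    using assms by (intro distr_cong refl) (simp add: space_ray_measure ray_act_gen)
  also have "\<dots> = density (ray_measure n) (\<lambda>\<xi>. ennreal (letter_density n x \<xi>))"
  proof (cases "\<bar>x\<bar> \<le> real n")
    case True
    then have "x \<in> letters n" using assms letters_restrict by auto
    then show ?thesis
      using distr_ray_push[OF assms(1)] True by (simp add: kill_def[abs_def])
  next
    case False
    then show ?thesis
      by (simp add: kill_def[abs_def] letter_density_def[abs_def] density_1 distr_id[unfolded id_def])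
  qed
  finally show ?thesis .
qed

text \<open>Stationarity in terms of densities: the first letter of the ray contributes 2n - 1, the
  other surviving letters 1 in total, the killed ones 2d - 2n.\<close>

lemma sum_letter_density:
  assumes "1 \<le> n" "n \<le> d" "\<xi> \<in> rays n"
  shows "(\<Sum>x\<in>letters d. letter_density n x \<xi>) = 2 * real d"
proof -
  have sub: "letters n \<subseteq> letters d"
    using letters_restrict[OF assms(2)] by auto
  have mem: "\<xi> 0 \<in> letters n" using assms(3) by (simp add: rays_def)
  have "(\<Sum>x\<in>letters d. letter_density n x \<xi>) =
      (\<Sum>x\<in>letters d - letters n. letter_density n x \<xi>) + (\<Sum>x\<in>letters n. letter_density n x \<xi>)"
    by (rule sum.subset_diff) (use sub in auto)
  also have "(\<Sum>x\<in>letters d - letters n. letter_density n x \<xi>) = (\<Sum>x\<in>letters d - letters n. 1)"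
    by (rule sum.cong) (use letters_restrict[OF assms(2)] in \<open>auto simp: letter_density_def\<close>)
  also have "\<dots> = 2 * real d - 2 * real n"
    using assms(2) sub by (simp add: card_Diff_subset card_letters of_nat_diff)
  also have "(\<Sum>x\<in>letters n. letter_density n x \<xi>) =
      letter_density n (\<xi> 0) \<xi> + (\<Sum>x\<in>letters n - {\<xi> 0}. letter_density n x \<xi>)"
    by (rule sum.remove) (use mem in auto)
  also have "letter_density n (\<xi> 0) \<xi> = 2 * real n - 1"
    using mem by (auto simp: letter_density_def letters_def)
  also have "(\<Sum>x\<in>letters n - {\<xi> 0}. letter_density n x \<xi>) = (\<Sum>x\<in>letters n - {\<xi> 0}. 1 / (2 * real n - 1))"
    by (rule sum.cong) (auto simp: letter_density_def letters_def)
  also have "\<dots> = 1"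
    using mem assms(1) by (simp add: card_letters of_nat_diff)
  finally show ?thesis by simp
qed

lemma stationary_ray_measure:
  assumes "1 \<le> n" "n \<le> d" "A \<in> sets (ray_measure n)"
  shows "(\<integral>\<^sup>+g. emeasure (distr (ray_measure n) (ray_measure n) (ray_act n g)) A \<partial>measure_pmf \<mu>) =
    emeasure (ray_measure n) A"
proof -
  let ?\<nu> = "ray_measure n"
  note [measurable] = letter_density_measurable[OF assms(1)] assms(3)
  have "(\<integral>\<^sup>+g. emeasure (distr ?\<nu> ?\<nu> (ray_act n g)) A \<partial>measure_pmf \<mu>) =
      (\<Sum>x\<in>letters d. emeasure (distr ?\<nu> ?\<nu> (ray_act n (gen x))) A) / of_nat (card (letters d))"
    unfolding \<mu>_def nn_integral_map_pmf by (rule nn_integral_pmf_of_set) (use letters_neq_empty in auto)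
  also have "(\<Sum>x\<in>letters d. emeasure (distr ?\<nu> ?\<nu> (ray_act n (gen x))) A) =
      (\<Sum>x\<in>letters d. \<integral>\<^sup>+\<xi>. ennreal (letter_density n x \<xi>) * indicator A \<xi> \<partial>?\<nu>)"
    using assms by (intro sum.cong refl) (simp add: distr_ray_act_gen emeasure_density)
  also have "\<dots> = (\<integral>\<^sup>+\<xi>. (\<Sum>x\<in>letters d. ennreal (letter_density n x \<xi>) * indicator A \<xi>) \<partial>?\<nu>)"
    by (intro nn_integral_sum[symmetric]) measurable
  also have "\<dots> = (\<integral>\<^sup>+\<xi>. ennreal (2 * real d) * indicator A \<xi> \<partial>?\<nu>)"
  proof (rule nn_integral_cong)
    fix \<xi> assume "\<xi> \<in> space ?\<nu>"
    then have "(\<Sum>x\<in>letters d. ennreal (letter_density n x \<xi>)) = ennreal (2 * real d)"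
      using assms by (subst sum_ennreal)
        (simp_all add: sum_letter_density space_ray_measure letter_density_pos less_imp_le)
    then show "(\<Sum>x\<in>letters d. ennreal (letter_density n x \<xi>) * indicator A \<xi>) = ennreal (2 * real d) * indicator A \<xi>"
      by (simp flip: sum_distrib_right)
  qed
  also have "\<dots> = ennreal (2 * real d) * emeasure ?\<nu> A"
    using assms(3) by (rule nn_integral_cmult_indicator)
  also have "of_nat (card (letters d)) = ennreal (2 * real d)"
    by (simp add: card_letters ennreal_of_nat_eq_real_of_nat)
  also have "ennreal (2 * real d) * emeasure ?\<nu> A / ennreal (2 * real d) = emeasure ?\<nu> A"
    using d_ge_2 by (subst mult.commute, intro ennreal_mult_divide_eq) auto
  finally show ?thesis .
qed

lemma stationary_space_rays:
  assumes "1 \<le> n" "n \<le> d"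
  shows "stationary_space \<Gamma> \<mu> (ray_space n) (ray_act n) (ray_measure n)"
  unfolding stationary_space_def
  using assms set_pmf_\<mu>_subset compact_space_ray_space metrizable_space_ray_space
    continuous_action_ray_act prob_space_ray_measure sets_ray_measure stationary_ray_measure by blast

text \<open>Each of the 2n surviving letters contributes (n - 1) / n * ln (2n - 1), the killed ones
  nothing, and the sum is divided by 2d.\<close>

lemma furstenberg_entropy_rays:
  assumes "1 \<le> n" "n \<le> d"
  shows "furstenberg_entropy \<Gamma> \<mu> (ray_act n) (ray_measure n) =
    (real n - 1) / real d * ln (2 * real n - 1)"
proof -
  let ?\<nu> = "ray_measure n"
  let ?h = "\<lambda>x. \<integral>\<xi>. - ln (letter_density n x \<xi>) \<partial>?\<nu>"
  interpret prob_space ?\<nu> by (rule prob_space_ray_measure[OF assms(1)])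
  note [measurable] = letter_density_measurable[OF assms(1)]
  have sub: "letters n \<subseteq> letters d"
    using letters_restrict[OF assms(2)] by auto
  have h: "(\<integral>\<xi>. - ln (enn2real (RN_deriv ?\<nu> (distr ?\<nu> ?\<nu> (ray_act n (inv (gen x)))) \<xi>)) \<partial>?\<nu>) = ?h (- x)"
    if x: "x \<in> letters d" for x
  proof (rule integral_cong_AE)
    have eq: "density ?\<nu> (\<lambda>\<xi>. ennreal (letter_density n (- x) \<xi>)) = distr ?\<nu> ?\<nu> (ray_act n (inv (gen x)))"
      using distr_ray_act_gen[OF assms, of "- x"] x by (simp add: gen_uminus)
    have "ray_act n (inv (gen x)) \<in> measurable ?\<nu> ?\<nu>"
      using assms x by (intro measurable_ray_measure continuous_map_ray_act) auto
    then have "sigma_finite_measure (distr ?\<nu> ?\<nu> (ray_act n (inv (gen x))))"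
      by (intro prob_space_imp_sigma_finite prob_space_distr)
    \<comment> \<open>\<open>RN_deriv\<close> is determined only up to null sets, so the explicit
      density can replace it only under the integral.\<close>
    then have "AE \<xi> in ?\<nu>. ennreal (letter_density n (- x) \<xi>) =
        RN_deriv ?\<nu> (distr ?\<nu> ?\<nu> (ray_act n (inv (gen x)))) \<xi>"
      using eq by (intro RN_deriv_unique_sigma_finite) auto
    then show "AE \<xi> in ?\<nu>. - ln (enn2real (RN_deriv ?\<nu> (distr ?\<nu> ?\<nu> (ray_act n (inv (gen x)))) \<xi>)) =
        - ln (letter_density n (- x) \<xi>)"
    proof eventually_elim
      case (elim \<xi>)
      show ?case
        unfolding elim[symmetric] using letter_density_pos[OF assms(1), of "- x" \<xi>] by simp
    qed
  qed measurable
  have "furstenberg_entropy \<Gamma> \<mu> (ray_act n) ?\<nu> =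
      (\<Sum>x\<in>letters d. \<integral>\<xi>. - ln (enn2real (RN_deriv ?\<nu> (distr ?\<nu> ?\<nu> (ray_act n (inv (gen x)))) \<xi>)) \<partial>?\<nu>) /
        real (card (letters d))"
    unfolding furstenberg_entropy_def \<mu>_def integral_map_pmf
    by (rule integral_pmf_of_set) (use letters_neq_empty in auto)
  also have "\<dots> = (\<Sum>x\<in>letters d. ?h (- x)) / (2 * real d)"
    using h by (simp add: card_letters)
  also have "(\<Sum>x\<in>letters d. ?h (- x)) = (\<Sum>x\<in>letters d. ?h x)"
    by (rule sum.reindex_bij_witness[of _ uminus uminus]) auto
  also have "\<dots> = (\<Sum>x\<in>letters d - letters n. ?h x) + (\<Sum>x\<in>letters n. ?h x)"
    by (rule sum.subset_diff) (use sub in auto)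
  also have "(\<Sum>x\<in>letters d - letters n. ?h x) = 0"
    by (rule sum.neutral) (use letters_restrict[OF assms(2)] in \<open>auto simp: letter_density_def\<close>)
  also have "(\<Sum>x\<in>letters n. ?h x) = (\<Sum>x\<in>letters n. (real n - 1) / real n * ln (2 * real n - 1))"
    by (intro sum.cong refl integral_ln_letter_density[OF assms(1)])
  also have "\<dots> = 2 * (real n - 1) * ln (2 * real n - 1)"
    using assms(1) by (simp add: card_letters)
  finally show ?thesis using d_ge_2 by (simp add: field_simps)
qed

end

section \<open>Proximality\<close>

context free_walk
begin

text \<open>The translation by \<open>g m\<close> sends all rays outside one small cylinder into a
  given neighbourhood of \<xi>; on that cylinder the boundedness of f suffices.\<close>

lemma weak_star_limit_ray_act:
  assumes n: "2 \<le> n" "n \<le> d"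
    and g: "\<And>m. g m \<in> carrier \<Gamma>"
    and \<xi>: "\<xi> \<in> rays n"
    and lim: "\<And>j. eventually (\<lambda>m. j \<le> length (red n (g m)) \<and> (\<forall>i<j. red n (g m) ! i = \<xi> i)) sequentially"
  shows "weak_star_limit (ray_space n)
    (\<lambda>m. distr (ray_measure n) (ray_measure n) (ray_act n (g m))) (return (borel_of (ray_space n)) \<xi>)"
  unfolding weak_star_limit_def
proof (intro allI impI)
  fix f :: "point \<Rightarrow> real" assume f: "continuous_map (ray_space n) euclideanreal f"
  let ?\<nu> = "ray_measure n"
  have n1: "1 \<le> n" using n by simp
  interpret prob_space ?\<nu> by (rule prob_space_ray_measure[OF n1])
  have "continuous_on (rays n) f" using f by (simp add: ray_space_def)
  then have "bounded (f ` rays n)"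
    by (intro compact_imp_bounded compact_continuous_image compact_rays)
  then obtain B where B: "B > 0" "\<And>\<eta>. \<eta> \<in> rays n \<Longrightarrow> \<bar>f \<eta>\<bar> \<le> B"
    unfolding bounded_pos by auto
  have act_meas: "ray_act n (g m) \<in> measurable ?\<nu> ?\<nu>" for m
    by (rule measurable_ray_measure[OF n1 continuous_map_ray_act[OF n(2) g]])
  have f_meas: "f \<in> borel_measurable ?\<nu>" by (rule borel_measurable_ray_measure[OF n1 f])
  have act_rays: "ray_act n (g m) \<eta> \<in> rays n" if "\<eta> \<in> rays n" for m \<eta>
    unfolding ray_act_def
    by (rule free_basis_action.letter_action_closed[OF rays_action[OF n(2)] g that])
  have int: "integrable ?\<nu> (\<lambda>\<eta>. f (ray_act n (g m) \<eta>))" for m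
  proof (rule integrable_const_bound[where B = B])
    show "AE \<eta> in ?\<nu>. norm (f (ray_act n (g m) \<eta>)) \<le> B"
      using B(2)[OF act_rays] by (intro AE_I2) (simp add: space_ray_measure[OF n1])
  qed (rule measurable_compose[OF act_meas f_meas])
  have "(\<lambda>m. \<integral>\<eta>. f (ray_act n (g m) \<eta>) \<partial>?\<nu>) \<longlonglongrightarrow> f \<xi>"
  proof (rule tendstoI)
    fix \<epsilon> :: real assume \<epsilon>: "\<epsilon> > 0"
    define U where "U = {\<eta> \<in> rays n. f \<eta> \<in> ball (f \<xi>) (\<epsilon> / 2)}"
    have "openin (ray_space n) U"
      using openin_continuous_map_preimage[OF f, of "ball (f \<xi>) (\<epsilon> / 2)"] by (simp add: U_def)
    moreover have "\<xi> \<in> U" using \<xi> \<epsilon> by (simp add: U_def)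
    ultimately obtain j where "\<forall>k\<ge>j. cylinder n (map \<xi> [0..<k]) \<subseteq> U"
      using ray_space_neighbourhood[of n U \<xi>] by auto
    then have j: "cylinder n (map \<xi> [0..<j]) \<subseteq> U" by simp
    \<comment> \<open>The base 3 is a lower bound for 2n - 1, as n \<ge> 2. The exceptional cylinder
      will cost at most 2B (1 / 3)^J < \<epsilon> / 2.\<close>
    obtain J where J: "(1 / 3) ^ J < \<epsilon> / (4 * B)"
      using real_arch_pow_inv[of "\<epsilon> / (4 * B)" "1 / 3"] \<epsilon> B(1) by auto
    \<comment> \<open>The first j letters fix the neighbourhood; at least J + 1 remain for the tail,
      one of which is spent on the factor 2n in the cylinder measure.\<close>
    show "eventually (\<lambda>m. dist (\<integral>\<eta>. f (ray_act n (g m) \<eta>) \<partial>?\<nu>) (f \<xi>) < \<epsilon>) sequentially"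
      using lim[of "j + J + 1"]
    proof eventually_elim
      case (elim m)
      define u where "u = take j (red n (g m))"
      define v where "v = drop j (red n (g m))"
      have uv: "u @ v = red n (g m)" "length u = j" "length v \<ge> J + 1" "\<And>i. i < j \<Longrightarrow> u ! i = \<xi> i"
        using elim by (auto simp: u_def v_def)
      have words: "u @ v \<in> words n" using red_words[OF n(2) g] by (simp add: uv)
      define C where "C = cylinder n (map uminus (rev v))"
      have C: "C \<in> sets ?\<nu>" by (simp add: C_def cylinder_in_sets[OF n1])
      have v: "map uminus (rev v) \<in> words n" "map uminus (rev v) \<noteq> []"
        using words uv(3) push_uminus_words[of v n] by (auto simp: append_words)
      have "measure ?\<nu> C = 1 / (2 * real n * (2 * real n - 1) ^ (length v - 1))"
        unfolding C_def measure_cylinder[OF n1 v] by simp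
      also have "\<dots> \<le> 1 / (1 * 3 ^ J)"
      proof (intro divide_left_mono mult_mono)
        have "(3 :: real) ^ J \<le> 3 ^ (length v - 1)" using uv(3) by (intro power_increasing) auto
        also have "\<dots> \<le> (2 * real n - 1) ^ (length v - 1)" using n(1) by (intro power_mono) auto
        finally show "(3 :: real) ^ J \<le> (2 * real n - 1) ^ (length v - 1)" .
      qed (use n1 in auto)
      finally have mC: "measure ?\<nu> C \<le> (1 / 3) ^ J" by (simp add: power_one_over)
      have bound: "\<bar>f (ray_act n (g m) \<eta>) - f \<xi>\<bar> \<le> \<epsilon> / 2 + 2 * B * indicator C \<eta>" if \<eta>: "\<eta> \<in> rays n" for \<eta>
      proof (cases "\<eta> \<in> C")
        case True
        have "\<bar>f (ray_act n (g m) \<eta>) - f \<xi>\<bar> \<le> B + B"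
          using B(2)[OF act_rays[OF \<eta>, of m]] B(2)[OF \<xi>] by linarith
        then show ?thesis using True \<epsilon> by simp
      next
        case False
        have "\<forall>i<length u. foldr ray_push (u @ v) \<eta> i = u ! i"
          using foldr_ray_push_prefix[OF words _ \<eta>] False v(2) by (simp add: C_def)
        then have "ray_act n (g m) \<eta> \<in> cylinder n (map \<xi> [0..<j])"
          using act_rays[OF \<eta>, of m] ray_act_eq_foldr[OF n(2) g \<eta>, of m] uv by (simp add: cylinder_def)
        then have "dist (f \<xi>) (f (ray_act n (g m) \<eta>)) < \<epsilon> / 2" using j by (auto simp: U_def)
        then show ?thesis using False by (simp add: dist_real_def abs_minus_commute)
      qed
      have "\<bar>(\<integral>\<eta>. f (ray_act n (g m) \<eta>) \<partial>?\<nu>) - f \<xi>\<bar> = \<bar>\<integral>\<eta>. f (ray_act n (g m) \<eta>) - f \<xi> \<partial>?\<nu>\<bar>"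
        using int by (simp add: prob_space)
      also have "\<dots> \<le> (\<integral>\<eta>. \<bar>f (ray_act n (g m) \<eta>) - f \<xi>\<bar> \<partial>?\<nu>)"
        by (rule integral_abs_bound)
      also have "\<dots> \<le> (\<integral>\<eta>. \<epsilon> / 2 + 2 * B * indicator C \<eta> \<partial>?\<nu>)"
      proof (rule integral_mono)
        show "integrable ?\<nu> (\<lambda>\<eta>. \<epsilon> / 2 + 2 * B * indicator C \<eta>)"
          using C by (simp add: integrable_real_indicator emeasure_eq_measure)
      qed (use int bound n1 in \<open>auto simp: space_ray_measure\<close>)
      also have "\<dots> = \<epsilon> / 2 + 2 * B * measure ?\<nu> C"
        using C by (simp add: prob_space integrable_real_indicator emeasure_eq_measure)
      also have "\<dots> \<le> \<epsilon> / 2 + 2 * B * (1 / 3) ^ J"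
        using mC B(1) by (intro add_left_mono mult_left_mono) auto
      also have "\<dots> < \<epsilon>"
        using J B(1) by (simp add: field_simps)
      finally show ?case by (simp add: dist_real_def)
    qed
  qed
  moreover have "(\<integral>\<eta>. f \<eta> \<partial>distr ?\<nu> ?\<nu> (ray_act n (g m))) = (\<integral>\<eta>. f (ray_act n (g m) \<eta>) \<partial>?\<nu>)" for m
    by (rule integral_distr[OF act_meas f_meas])
  moreover have "(\<integral>\<eta>. f \<eta> \<partial>return (borel_of (ray_space n)) \<xi>) = f \<xi>"
    by (rule integral_return) (use \<xi> borel_measurable_borel_of[OF f] in \<open>auto simp: space_borel_of\<close>)
  ultimately show "(\<lambda>m. \<integral>\<eta>. f \<eta> \<partial>distr ?\<nu> ?\<nu> (ray_act n (g m))) \<longlonglongrightarrow>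
      (\<integral>\<eta>. f \<eta> \<partial>return (borel_of (ray_space n)) \<xi>)"
    by simp
qed

text \<open>
  The type of group elements may be uncountable, in which case multiplication is not measurable on
  its square. Almost surely all steps lie in the countable carrier; clipping them to it
  restores measurability.
\<close>

definition clip :: "(nat \<Rightarrow> 'g) \<Rightarrow> nat \<Rightarrow> 'g" where
  "clip \<omega> i = (if \<omega> i \<in> carrier \<Gamma> then \<omega> i else \<one>)"

lemma walk_closed: "(\<And>i. \<omega> i \<in> carrier \<Gamma>) \<Longrightarrow> walk \<Gamma> \<omega> m \<in> carrier \<Gamma>"
  by (induction m) auto

lemma clip_closed [simp]: "clip \<omega> i \<in> carrier \<Gamma>"
  by (simp add: clip_def)

lemma walk_case_nat:
  assumes "s \<in> carrier \<Gamma>" "\<And>i. \<omega> i \<in> carrier \<Gamma>"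
  shows "walk \<Gamma> (case_nat s \<omega>) (Suc m) = s \<otimes> walk \<Gamma> \<omega> m"
proof (induction m)
  case (Suc m)
  have "walk \<Gamma> (case_nat s \<omega>) (Suc (Suc m)) = walk \<Gamma> (case_nat s \<omega>) (Suc m) \<otimes> \<omega> m" by simp
  also have "\<dots> = s \<otimes> (walk \<Gamma> \<omega> m \<otimes> \<omega> m)"
    unfolding Suc using assms walk_closed[of \<omega> m] by (simp add: m_assoc)
  finally show ?case by simp
qed (use assms in simp)

section \<open>The law of the walk on path space and almost sure convergence\<close>

abbreviation steps :: "(nat \<Rightarrow> 'g) measure" where
  "steps \<equiv> PiM UNIV (\<lambda>_. measure_pmf \<mu>)"

lemma sequence_space_\<mu>: "sequence_space (measure_pmf \<mu>)"
  unfolding sequence_space_def by (rule product_prob_spaceI) (rule measure_pmf.prob_space_axioms)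

lemma walk_clip_measurable: "(\<lambda>\<omega>. walk \<Gamma> (clip \<omega>) m) \<in> measurable steps (count_space (carrier \<Gamma>))"
proof (induction m)
  case (Suc m)
  have 1: "(\<lambda>\<omega>. \<omega> m) \<in> measurable steps (measure_pmf \<mu>)"
    by (rule measurable_component_singleton) simp
  have 2: "(\<lambda>h. g \<otimes> (if h \<in> carrier \<Gamma> then h else \<one>)) \<in>
      measurable (measure_pmf \<mu>) (count_space (carrier \<Gamma>))" if "g \<in> carrier \<Gamma>" for g
    using that by simp
  have "(\<lambda>\<omega>. g \<otimes> clip \<omega> m) \<in> measurable steps (count_space (carrier \<Gamma>))"
    if "g \<in> carrier \<Gamma>" for g
    unfolding clip_def by (rule measurable_compose[OF 1 2[OF that]])
  from measurable_compose_countable'[OF this Suc countable_carrier] show ?case by simp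
qed simp

text \<open>Splitting off the first step of the path (\<open>PiM_iter\<close>) matches
  \<open>conv_power_Suc_left\<close>; f stays arbitrary in the induction so that it can absorb this
  step.\<close>

lemma nn_integral_walk_clip:
  "(\<integral>\<^sup>+\<omega>. f (walk \<Gamma> (clip \<omega>) m) \<partial>steps) = (\<integral>\<^sup>+g. f g \<partial>measure_pmf (walk_pmf m))"
proof -
  interpret sequence_space "measure_pmf \<mu>" by (rule sequence_space_\<mu>)
  show ?thesis
  proof (induction m arbitrary: f)
    case 0
    then show ?case by (simp add: P.emeasure_space_1)
  next
    case (Suc m)
    let ?F = "\<lambda>\<omega>. f (walk \<Gamma> (clip \<omega>) (Suc m))"
    have F: "?F \<in> borel_measurable steps"
      by (rule measurable_compose[OF walk_clip_measurable]) simp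
    have c: "(\<lambda>(s, \<omega>). case_nat s \<omega>) \<in> measurable (measure_pmf \<mu> \<Otimes>\<^sub>M steps) steps"
      by measurable
    have "(\<integral>\<^sup>+\<omega>. ?F \<omega> \<partial>steps) = (\<integral>\<^sup>+p. ?F (case p of (s, \<omega>) \<Rightarrow> case_nat s \<omega>) \<partial>(measure_pmf \<mu> \<Otimes>\<^sub>M steps))"
      using nn_integral_distr[OF c, of ?F] F unfolding PiM_iter by blast
    also have "\<dots> = (\<integral>\<^sup>+s. (\<integral>\<^sup>+\<omega>. ?F (case_nat s \<omega>) \<partial>steps) \<partial>measure_pmf \<mu>)"
      using P.nn_integral_fst[OF measurable_compose[OF c F]] by simp
    also have "\<dots> = (\<integral>\<^sup>+s. (\<integral>\<^sup>+\<omega>. f (s \<otimes> walk \<Gamma> (clip \<omega>) m) \<partial>steps) \<partial>measure_pmf \<mu>)"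
    proof (rule nn_integral_cong_AE, simp only: AE_measure_pmf_iff, rule ballI)
      fix s assume "s \<in> set_pmf \<mu>"
      then have s: "s \<in> carrier \<Gamma>" using set_pmf_\<mu>_subset by blast
      then have "clip (case_nat s \<omega>) = case_nat s (clip \<omega>)" for \<omega>
        by (auto simp: clip_def fun_eq_iff split: nat.splits)
      then show "(\<integral>\<^sup>+\<omega>. ?F (case_nat s \<omega>) \<partial>steps) = (\<integral>\<^sup>+\<omega>. f (s \<otimes> walk \<Gamma> (clip \<omega>) m) \<partial>steps)"
        by (simp only: walk_case_nat[OF s clip_closed])
    qed
    also have "\<dots> = (\<integral>\<^sup>+s. (\<integral>\<^sup>+g. f (s \<otimes> g) \<partial>measure_pmf (walk_pmf m)) \<partial>measure_pmf \<mu>)"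
    proof (rule nn_integral_cong)
      show "(\<integral>\<^sup>+\<omega>. f (s \<otimes> walk \<Gamma> (clip \<omega>) m) \<partial>steps) = (\<integral>\<^sup>+g. f (s \<otimes> g) \<partial>measure_pmf (walk_pmf m))"
        for s by (rule Suc.IH[of "\<lambda>g. f (s \<otimes> g)"])
    qed
    also have "\<dots> = (\<integral>\<^sup>+g. f g \<partial>measure_pmf (walk_pmf (Suc m)))"
      unfolding conv_power_Suc_left[OF set_pmf_\<mu>_subset] by (simp add: nn_integral_bind_pmf)
    finally show ?case .
  qed
qed

lemma AE_steps: "AE \<omega> in steps. \<forall>i. \<omega> i \<in> gen ` letters d"
proof -
  interpret sequence_space "measure_pmf \<mu>" by (rule sequence_space_\<mu>)
  have "AE \<omega> in steps. \<omega> i \<in> gen ` letters d" for i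
    by (rule AE_component) (simp_all add: AE_measure_pmf_iff set_pmf_\<mu>)
  then show ?thesis by (simp add: AE_all_countable)
qed

text \<open>Transience by Borel-Cantelli: for fixed j the bounds of \<open>prob_length_le\<close>
  are summable in m.\<close>

lemma AE_walk_length:
  assumes n: "2 \<le> n" "n \<le> d"
  shows "AE \<omega> in steps. \<forall>j. eventually (\<lambda>m. j < length (red n (walk \<Gamma> (clip \<omega>) m))) sequentially"
proof -
  interpret sequence_space "measure_pmf \<mu>" by (rule sequence_space_\<mu>)
  have "AE \<omega> in steps. eventually (\<lambda>m. j < length (red n (walk \<Gamma> (clip \<omega>) m))) sequentially" for j
  proof -
    let ?G = "{g. length (red n g) \<le> j}"
    define A where "A m = {\<omega> \<in> space steps. walk \<Gamma> (clip \<omega>) m \<in> ?G}" for m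
    have A: "A m \<in> sets steps" for m
    proof -
      have "A m = (\<lambda>\<omega>. walk \<Gamma> (clip \<omega>) m) -` (?G \<inter> carrier \<Gamma>) \<inter> space steps"
        using walk_closed[OF clip_closed] by (auto simp: A_def)
      then show ?thesis
        using measurable_sets[OF walk_clip_measurable, of "?G \<inter> carrier \<Gamma>" m] by simp
    qed
    have "emeasure steps (A m) = (\<integral>\<^sup>+\<omega>. indicator ?G (walk \<Gamma> (clip \<omega>) m) \<partial>steps)" for m
      unfolding nn_integral_indicator[OF A, symmetric]
      by (rule nn_integral_cong) (simp add: A_def indicator_def)
    then have "emeasure steps (A m) = emeasure (measure_pmf (walk_pmf m)) ?G" for m
      by (simp add: nn_integral_walk_clip)
    then have meas: "measure steps (A m) = measure_pmf.prob (walk_pmf m) ?G" for m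
      by (simp add: measure_def)
    have sp: "0 \<le> spectral n" "spectral n < 1"
      using n by (auto simp: spectral_nonneg spectral_less_one)
    have "summable (\<lambda>m. measure steps (A m))"
    proof (rule summable_comparison_test')
      show "summable (\<lambda>m. sqrt (2 * real n - 1) ^ j * spectral n ^ m)"
        using sp by (intro summable_mult summable_geometric) auto
      show "norm (measure steps (A m)) \<le> sqrt (2 * real n - 1) ^ j * spectral n ^ m" for m
        using prob_length_le[of n m j] n unfolding meas by simp
    qed
    then have "AE \<omega> in steps. eventually (\<lambda>m. \<omega> \<in> space steps - A m) sequentially"
      by (intro borel_cantelli_AE1 A) (simp add: P.emeasure_eq_measure less_top[symmetric])
    then show ?thesis
      by (rule AE_mp, intro AE_I2 impI) (auto simp: A_def elim: eventually_mono)
  qed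
  then show ?thesis by (simp add: AE_all_countable)
qed

lemma proximal_rays:
  assumes n: "2 \<le> n" "n \<le> d"
  shows "proximal \<Gamma> \<mu> (ray_space n) (ray_act n) (ray_measure n)"
  unfolding proximal_def
  using AE_steps AE_walk_length[OF n]
proof eventually_elim
  case (elim \<omega>)
  have gen: "\<exists>x\<in>letters d. \<omega> i = gen x" for i using elim(1) by blast
  then have carrier: "\<omega> i \<in> carrier \<Gamma>" for i by (metis gen_closed)
  then have "clip \<omega> = \<omega>" by (simp add: clip_def fun_eq_iff)
  note walk = walk_closed[of \<omega>, OF carrier]
  have "\<exists>\<xi>\<in>rays n. \<forall>j. eventually (\<lambda>m. j \<le> length (red n (walk \<Gamma> \<omega> m)) \<and>
      (\<forall>i<j. red n (walk \<Gamma> \<omega> m) ! i = \<xi> i)) sequentially"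
  proof (rule words_limit_ray)
    show "red n (walk \<Gamma> \<omega> m) \<in> words n" for m by (rule red_words[OF n(2) walk])
    show "eventually (\<lambda>m. j < length (red n (walk \<Gamma> \<omega> m))) sequentially" for j
      using elim(2) unfolding \<open>clip \<omega> = \<omega>\<close> by blast
    fix m
    obtain x where "x \<in> letters d" "\<omega> m = gen x" using gen by blast
    then have "red n (walk \<Gamma> \<omega> (Suc m)) = red n (walk \<Gamma> \<omega> m \<otimes> gen x)" by simp
    also have "\<dots> = (if \<bar>x\<bar> \<le> real n then
         (if red n (walk \<Gamma> \<omega> m) \<noteq> [] \<and> last (red n (walk \<Gamma> \<omega> m)) = - x
          then butlast (red n (walk \<Gamma> \<omega> m)) else red n (walk \<Gamma> \<omega> m) @ [x])
       else red n (walk \<Gamma> \<omega> m))"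
      by (rule red_mult_gen[OF n(2) \<open>x \<in> letters d\<close> walk])
    finally show "red n (walk \<Gamma> \<omega> (Suc m)) = red n (walk \<Gamma> \<omega> m) \<or>
        red n (walk \<Gamma> \<omega> (Suc m)) = butlast (red n (walk \<Gamma> \<omega> m)) \<or>
        (\<exists>x. red n (walk \<Gamma> \<omega> (Suc m)) = red n (walk \<Gamma> \<omega> m) @ [x])"
      by (auto simp del: walk.simps split: if_splits)
  qed
  then show ?case
    using weak_star_limit_ray_act[where g = "walk \<Gamma> \<omega>", OF n walk] by fastforce
qed

lemma boundary_rays:
  "2 \<le> n \<Longrightarrow> n \<le> d \<Longrightarrow> boundary \<Gamma> \<mu> (ray_space n) (ray_act n) (ray_measure n)"
  by (simp add: boundary_def stationary_space_rays proximal_rays)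

section \<open>The trivial boundary\<close>

definition point_space :: "point topology" where
  "point_space = top_of_set {\<lambda>_. 0}"

definition point_act :: "'g \<Rightarrow> point \<Rightarrow> point" where
  "point_act = letter_action (\<lambda>_ s. s) {\<lambda>_. 0}"

definition point_measure :: "point measure" where
  "point_measure = return (borel_of point_space) (\<lambda>_. 0)"

lemma foldr_const: "foldr (\<lambda>_ s. s) w s = s"
  by (induction w) auto

lemma distr_point_act: "distr point_measure point_measure (point_act g) = point_measure"
proof -
  have "distr point_measure point_measure (point_act g) = distr point_measure point_measure (\<lambda>s. s)"
    by (rule distr_cong) (auto simp: point_act_def letter_action_def foldr_const point_measure_def
        space_borel_of point_space_def)
  then show ?thesis by (simp add: distr_id[unfolded id_def])
qed

lemma prob_space_point_measure: "prob_space point_measure"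
  unfolding point_measure_def by (rule prob_space_return) (simp add: space_borel_of point_space_def)

lemma boundary_point: "boundary \<Gamma> \<mu> point_space point_act point_measure"
proof -
  interpret free_basis_action \<Gamma> a d "\<lambda>_ s. s" "{\<lambda>_. 0} :: point set"
    by unfold_locales auto
  have "continuous_map point_space point_space (point_act g)" for g
    unfolding point_space_def
    by (rule continuous_map_eq[OF continuous_map_id])
      (auto simp: point_act_def letter_action_def foldr_const)
  then have "continuous_action \<Gamma> point_space point_act"
    using group_action_letter_action by (simp add: continuous_action_def point_space_def point_act_def)
  moreover have "compact_space point_space" "metrizable_space point_space"
    by (simp_all add: point_space_def compact_space_subtopology metrizable_space_subtopology metrizable_space_euclidean)
  moreover have "proximal \<Gamma> \<mu> point_space point_act point_measure"
    unfolding proximal_def distr_point_act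
    by (intro AE_I2 bexI[of _ "\<lambda>_. 0"])
      (auto simp: weak_star_limit_def point_measure_def point_space_def)
  ultimately show ?thesis
    using set_pmf_\<mu>_subset prob_space_point_measure
    by (simp add: boundary_def stationary_space_def distr_point_act measure_pmf.emeasure_space_1)
      (simp add: point_measure_def)
qed

lemma furstenberg_entropy_point: "furstenberg_entropy \<Gamma> \<mu> point_act point_measure = 0"
proof -
  interpret prob_space point_measure by (rule prob_space_point_measure)
  have "AE x in point_measure. 1 = RN_deriv point_measure point_measure x"
    by (rule RN_deriv_unique_sigma_finite) (auto simp: density_1 sigma_finite_measure_axioms)
  then have "(\<integral>x. - ln (enn2real (RN_deriv point_measure point_measure x)) \<partial>point_measure) =
      (\<integral>x. 0 \<partial>point_measure)"
    by (intro integral_cong_AE) auto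
  then show ?thesis by (simp add: furstenberg_entropy_def distr_point_act)
qed

end

section \<open>Comparison of the entropies\<close>

theorem theorem1:
  fixes \<Gamma> :: "('g, 'm) monoid_scheme" and a :: "nat \<Rightarrow> 'g" and d :: nat and \<mu> :: "'g pmf"
  assumes "d \<ge> 2"
    and "group \<Gamma>"
    and "freely_generates \<Gamma> {1..d} a"
    and "\<mu> = pmf_of_set (symmetric_set \<Gamma> {1..d} a)"
  shows "\<exists>(B :: nat \<Rightarrow> point topology) (act :: nat \<Rightarrow> 'g \<Rightarrow> point \<Rightarrow> point) (\<nu> :: nat \<Rightarrow> point measure).
           (\<forall>n. boundary \<Gamma> \<mu> (B n) (act n) (\<nu> n)) \<and>
           (\<forall>\<epsilon>::real. \<epsilon> > 0 \<longrightarrow>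
              (\<exists>n. rw_entropy \<Gamma> \<mu> > furstenberg_entropy \<Gamma> \<mu> (act n) (\<nu> n) \<and>
                   furstenberg_entropy \<Gamma> \<mu> (act n) (\<nu> n) >
                     (real d - 2) / (2 * real d - 2) * rw_entropy \<Gamma> \<mu> - \<epsilon>))"
proof -
  interpret F: free_walk \<Gamma> a d
    using assms(1-3) by (simp add: free_walk_def free_walk_axioms_def free_basis_def free_basis_axioms_def)
  have \<mu>: "\<mu> = F.\<mu>" by (simp add: assms(4) F.\<mu>_eq)
  have suffices: ?thesis
    if "boundary \<Gamma> \<mu> X f \<nu>" "furstenberg_entropy \<Gamma> \<mu> f \<nu> < rw_entropy \<Gamma> \<mu>"
      "(real d - 2) / (2 * real d - 2) * rw_entropy \<Gamma> \<mu> \<le> furstenberg_entropy \<Gamma> \<mu> f \<nu>"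
    for X :: "point topology" and f \<nu>
    using that by (intro exI[of _ "\<lambda>_. X"] exI[of _ "\<lambda>_. f"] exI[of _ "\<lambda>_. \<nu>"]) fastforce
  have h: "rw_entropy \<Gamma> \<mu> = (real d - 1) / real d * ln (2 * real d - 1)"
    unfolding \<mu> by (rule F.rw_entropy_eq)
  have ln_pos: "ln (2 * real d - 1) > 0" using assms(1) by simp
  show ?thesis
  proof (cases "d = 2")
    case True
    have f: "furstenberg_entropy \<Gamma> \<mu> F.point_act F.point_measure = 0"
      unfolding \<mu> by (rule F.furstenberg_entropy_point)
    show ?thesis
    proof (rule suffices)
      show "boundary \<Gamma> \<mu> F.point_space F.point_act F.point_measure"
        unfolding \<mu> by (rule F.boundary_point)
      show "furstenberg_entropy \<Gamma> \<mu> F.point_act F.point_measure < rw_entropy \<Gamma> \<mu>"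
        unfolding f h using ln_pos assms(1) by simp
      show "(real d - 2) / (2 * real d - 2) * rw_entropy \<Gamma> \<mu> \<le>
          furstenberg_entropy \<Gamma> \<mu> F.point_act F.point_measure"
        unfolding f using True by simp
    qed
  next
    case False
    then have d: "d \<ge> 3" using assms(1) by simp
    have f: "furstenberg_entropy \<Gamma> \<mu> (F.ray_act (d - 1)) (ray_measure (d - 1)) =
        (real d - 2) / real d * ln (2 * real d - 3)"
      unfolding \<mu> using d by (subst F.furstenberg_entropy_rays) (auto simp: of_nat_diff algebra_simps)
    show ?thesis
    proof (rule suffices)
      show "boundary \<Gamma> \<mu> (ray_space (d - 1)) (F.ray_act (d - 1)) (ray_measure (d - 1))"
        unfolding \<mu> using d by (intro F.boundary_rays) auto
      have "(real d - 2) / real d * ln (2 * real d - 3) \<le> (real d - 2) / real d * ln (2 * real d - 1)"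
        using d by (intro mult_left_mono) auto
      \<comment> \<open>Strictness comes from the coefficient d - 2 < d - 1.\<close>
      also have "\<dots> < (real d - 1) / real d * ln (2 * real d - 1)"
        using d ln_pos by (intro mult_strict_right_mono divide_strict_right_mono) auto
      finally show "furstenberg_entropy \<Gamma> \<mu> (F.ray_act (d - 1)) (ray_measure (d - 1)) < rw_entropy \<Gamma> \<mu>"
        unfolding f h .
      have "2 * real d - 1 \<le> (2 * real d - 3) ^ 2"
      proof -
        \<comment> \<open>The difference (2d - 3)^2 - (2d - 1) equals (d - 3) (4d - 2) + 4.\<close>
        have "0 \<le> (real d - 3) * (4 * real d - 2)" using d by (intro mult_nonneg_nonneg) auto
        then show ?thesis using d by (simp add: power2_eq_square algebra_simps)
      qed
      then have "ln (2 * real d - 1) \<le> ln ((2 * real d - 3) ^ 2)"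
        using d by (subst ln_le_cancel_iff) auto
      also have "\<dots> = 2 * ln (2 * real d - 3)" using d by (simp add: ln_realpow)
      finally have "(real d - 2) / (2 * real d) * ln (2 * real d - 1) \<le>
          (real d - 2) / (2 * real d) * (2 * ln (2 * real d - 3))"
        using d by (intro mult_left_mono) auto
      moreover have "(real d - 2) / (2 * real d - 2) * rw_entropy \<Gamma> \<mu> =
          (real d - 2) / (2 * real d) * ln (2 * real d - 1)"
      proof -
        have "2 * real d - 2 = 2 * (real d - 1)" "real d - 1 \<noteq> 0" using d by auto
        then show ?thesis unfolding h by (simp del: right_diff_distrib_numeral)
      qed
      ultimately show "(real d - 2) / (2 * real d - 2) * rw_entropy \<Gamma> \<mu> \<le>
          furstenberg_entropy \<Gamma> \<mu> (F.ray_act (d - 1)) (ray_measure (d - 1))"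
        unfolding f by simp
    qed
  qed
qed

end
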